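(* Let $\mathcal{A}$ be an AB3 abelian category and $\mathcal{B}$ be a full additive coreflective subcategory. The following assertions are equivalent: (1) $\mathcal{B}$ is abelian. (2) For every morphism $f:B\to B'$ in $\mathcal{B}$, the canonical morphism $\overline{f}:\frac{B}{\operatorname{tr}_{\mathcal{B}}(\operatorname{Ker} f)}\to\operatorname{Im} f$ is a $\mathcal{B}$-coreflection.
   Context: AB3 means cocomplete. Subcategories are full and closed under isomorphisms. $\mathcal{B}$ is coreflective if the inclusion $\mathcal{B}\to\mathcal{A}$ has a right adjoint. Kernels and images of $f$ are taken in $\mathcal{A}$. An object is $\mathcal{B}$-generated if it is an epimorphic image (in $\mathcal{A}$) of a coproduct of objects of $\mathcal{B}$. For an object $A$ of $\mathcal{A}$, the trace $\operatorname{tr}_{\mathcal{B}}(A)$ is the largest $\mathcal{B}$-generated subobject of $A$, i.e. the $\mathcal{B}$-generated subobject containing every $\mathcal{B}$-generated subobject of $A$; it exists because $\mathcal{B}$ is coreflective, hence precovering (it is the image of any $\mathcal{B}$-precover of $A$). The morphism $\overline{f}$ is the one induced by $f$. A $\mathcal{B}$-coreflection of $A$ is a morphism $p:B_A\to A$ with $B_A\in\mathcal{B}$ such that $\mathcal{A}(B,p):\mathcal{A}(B,B_A)\to\mathcal{A}(B,A)$ is bijective for every $B\in\mathcal{B}$. *)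

theory Defs
  imports "HOL-Algebra.Group" "HOL-Library.Equipollence"
begin

section \<open>Categories and functors\<close>

record ('o, 'm) cat_data =
  Obj :: "'o set"
  Mor :: "'m set"
  Dom :: "'m \<Rightarrow> 'o"
  Cod :: "'m \<Rightarrow> 'o"
  Idt :: "'o \<Rightarrow> 'm"
  Comp :: "'m \<Rightarrow> 'm \<Rightarrow> 'm"  (infixl "\<cdot>\<index>" 70)

definition Hom :: "('o, 'm, 'z) cat_data_scheme \<Rightarrow> 'o \<Rightarrow> 'o \<Rightarrow> 'm set" where
  "Hom C X Y = {f \<in> Mor C. Dom C f = X \<and> Cod C f = Y}"

locale category =
  fixes C :: "('o, 'm, 'z) cat_data_scheme" (structure)
  assumes Dom_in_Obj: "f \<in> Mor C \<Longrightarrow> Dom C f \<in> Obj C"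
    and Cod_in_Obj: "f \<in> Mor C \<Longrightarrow> Cod C f \<in> Obj C"
    and Idt_in_Hom: "X \<in> Obj C \<Longrightarrow> Idt C X \<in> Hom C X X"
    and Comp_in_Hom: "f \<in> Hom C X Y \<Longrightarrow> g \<in> Hom C Y Z \<Longrightarrow> g \<cdot> f \<in> Hom C X Z"
    and Idt_left: "f \<in> Hom C X Y \<Longrightarrow> Idt C Y \<cdot> f = f"
    and Idt_right: "f \<in> Hom C X Y \<Longrightarrow> f \<cdot> Idt C X = f"
    and Comp_assoc: "f \<in> Hom C W X \<Longrightarrow> g \<in> Hom C X Y \<Longrightarrow> h \<in> Hom C Y Z \<Longrightarrow>
      (h \<cdot> g) \<cdot> f = h \<cdot> (g \<cdot> f)"

definition is_mono :: "('o, 'm, 'z) cat_data_scheme \<Rightarrow> 'm \<Rightarrow> bool" where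
  "is_mono C f \<longleftrightarrow> f \<in> Mor C \<and>
     (\<forall>Z \<in> Obj C. \<forall>g \<in> Hom C Z (Dom C f). \<forall>h \<in> Hom C Z (Dom C f).
        f \<cdot>\<^bsub>C\<^esub> g = f \<cdot>\<^bsub>C\<^esub> h \<longrightarrow> g = h)"

definition is_epi :: "('o, 'm, 'z) cat_data_scheme \<Rightarrow> 'm \<Rightarrow> bool" where
  "is_epi C f \<longleftrightarrow> f \<in> Mor C \<and>
     (\<forall>Z \<in> Obj C. \<forall>g \<in> Hom C (Cod C f) Z. \<forall>h \<in> Hom C (Cod C f) Z.
        g \<cdot>\<^bsub>C\<^esub> f = h \<cdot>\<^bsub>C\<^esub> f \<longrightarrow> g = h)"

definition isomorphic :: "('o, 'm, 'z) cat_data_scheme \<Rightarrow> 'o \<Rightarrow> 'o \<Rightarrow> bool" where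
  "isomorphic C X Y \<longleftrightarrow>
     (\<exists>f \<in> Hom C X Y. \<exists>g \<in> Hom C Y X. g \<cdot>\<^bsub>C\<^esub> f = Idt C X \<and> f \<cdot>\<^bsub>C\<^esub> g = Idt C Y)"

definition is_functor ::
  "('o, 'm, 'z) cat_data_scheme \<Rightarrow> ('p, 'n, 'y) cat_data_scheme \<Rightarrow>
     ('o \<Rightarrow> 'p) \<Rightarrow> ('m \<Rightarrow> 'n) \<Rightarrow> bool" where
  "is_functor C D Fo Fm \<longleftrightarrow> category C \<and> category D \<and>
     (\<forall>X \<in> Obj C. Fo X \<in> Obj D) \<and>
     (\<forall>X \<in> Obj C. \<forall>Y \<in> Obj C. \<forall>f \<in> Hom C X Y. Fm f \<in> Hom D (Fo X) (Fo Y)) \<and>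
     (\<forall>X \<in> Obj C. Fm (Idt C X) = Idt D (Fo X)) \<and>
     (\<forall>X \<in> Obj C. \<forall>Y \<in> Obj C. \<forall>Z \<in> Obj C. \<forall>f \<in> Hom C X Y. \<forall>g \<in> Hom C Y Z.
        Fm (g \<cdot>\<^bsub>C\<^esub> f) = Fm g \<cdot>\<^bsub>D\<^esub> Fm f)"

text \<open>\<open>G\<close> is right adjoint to \<open>F\<close>: bijections from \<open>D(F X, Y)\<close> to \<open>C(X, G Y)\<close>,
  natural in \<open>X\<close> and \<open>Y\<close>.\<close>

definition is_right_adjoint ::
  "('o, 'm, 'z) cat_data_scheme \<Rightarrow> ('p, 'n, 'y) cat_data_scheme \<Rightarrow>
     ('o \<Rightarrow> 'p) \<Rightarrow> ('m \<Rightarrow> 'n) \<Rightarrow> ('p \<Rightarrow> 'o) \<Rightarrow> ('n \<Rightarrow> 'm) \<Rightarrow> bool" where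
  "is_right_adjoint C D Fo Fm Go Gm \<longleftrightarrow>
     is_functor C D Fo Fm \<and> is_functor D C Go Gm \<and>
     (\<exists>\<phi> :: 'o \<Rightarrow> 'p \<Rightarrow> 'n \<Rightarrow> 'm.
        (\<forall>X \<in> Obj C. \<forall>Y \<in> Obj D. bij_betw (\<phi> X Y) (Hom D (Fo X) Y) (Hom C X (Go Y))) \<and>
        (\<forall>X' \<in> Obj C. \<forall>X \<in> Obj C. \<forall>Y \<in> Obj D. \<forall>Y' \<in> Obj D.
           \<forall>u \<in> Hom C X' X. \<forall>h \<in> Hom D (Fo X) Y. \<forall>v \<in> Hom D Y Y'.
             \<phi> X' Y' (v \<cdot>\<^bsub>D\<^esub> h \<cdot>\<^bsub>D\<^esub> Fm u) = Gm v \<cdot>\<^bsub>C\<^esub> \<phi> X Y h \<cdot>\<^bsub>C\<^esub> u))"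


section \<open>Small colimits\<close>

text \<open>Smallness is measured by a type \<open>'u\<close>: a set is small if its cardinality is strictly less
  than that of \<open>'u\<close>. Taking \<open>'u\<close> to be of the cardinality of a Grothendieck universe gives the
  usual notion. Every small set (category) has a copy carried by the type \<open>'u\<close>, so
  index sets and index categories are taken there.\<close>

definition small :: "'u set \<Rightarrow> bool" where
  "small I \<longleftrightarrow> I \<prec> (UNIV :: 'u set)"

definition is_cocone ::
  "('i, 'j, 'y) cat_data_scheme \<Rightarrow> ('o, 'm, 'z) cat_data_scheme \<Rightarrow>
     ('i \<Rightarrow> 'o) \<Rightarrow> ('j \<Rightarrow> 'm) \<Rightarrow> 'o \<Rightarrow> ('i \<Rightarrow> 'm) \<Rightarrow> bool" where
  "is_cocone J C Do Dm N c \<longleftrightarrow> N \<in> Obj C \<and>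
     (\<forall>i \<in> Obj J. c i \<in> Hom C (Do i) N) \<and>
     (\<forall>u \<in> Mor J. c (Cod J u) \<cdot>\<^bsub>C\<^esub> Dm u = c (Dom J u))"

definition is_colimit ::
  "('i, 'j, 'y) cat_data_scheme \<Rightarrow> ('o, 'm, 'z) cat_data_scheme \<Rightarrow>
     ('i \<Rightarrow> 'o) \<Rightarrow> ('j \<Rightarrow> 'm) \<Rightarrow> 'o \<Rightarrow> ('i \<Rightarrow> 'm) \<Rightarrow> bool" where
  "is_colimit J C Do Dm L c \<longleftrightarrow> is_cocone J C Do Dm L c \<and>
     (\<forall>N d. is_cocone J C Do Dm N d \<longrightarrow>
        (\<exists>!h. h \<in> Hom C L N \<and> (\<forall>i \<in> Obj J. h \<cdot>\<^bsub>C\<^esub> c i = d i)))"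

definition cocomplete :: "'u itself \<Rightarrow> ('o, 'm, 'z) cat_data_scheme \<Rightarrow> bool" where
  "cocomplete (_ :: 'u itself) C \<longleftrightarrow>
     (\<forall>(J :: ('u, 'u) cat_data) Do Dm.
        small (Obj J) \<and> small (Mor J) \<and> is_functor J C Do Dm \<longrightarrow>
          (\<exists>L c. is_colimit J C Do Dm L c))"

definition is_coproduct ::
  "('o, 'm, 'z) cat_data_scheme \<Rightarrow> 'i set \<Rightarrow> ('i \<Rightarrow> 'o) \<Rightarrow> 'o \<Rightarrow> ('i \<Rightarrow> 'm) \<Rightarrow> bool" where
  "is_coproduct C I X P \<iota> \<longleftrightarrow> P \<in> Obj C \<and>
     (\<forall>i \<in> I. \<iota> i \<in> Hom C (X i) P) \<and>
     (\<forall>Y \<in> Obj C. \<forall>g. (\<forall>i \<in> I. g i \<in> Hom C (X i) Y) \<longrightarrow>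
        (\<exists>!h. h \<in> Hom C P Y \<and> (\<forall>i \<in> I. h \<cdot>\<^bsub>C\<^esub> \<iota> i = g i)))"


section \<open>Additive and abelian categories\<close>

record ('o, 'm) preadd_data = "('o, 'm) cat_data" +
  Add :: "'m \<Rightarrow> 'm \<Rightarrow> 'm"  (infixl "\<oplus>\<index>" 65)
  Zero :: "'o \<Rightarrow> 'o \<Rightarrow> 'm"

locale preadditive_category = category C
  for C :: "('o, 'm, 'z) preadd_data_scheme" (structure) +
  assumes Hom_comm_group: "X \<in> Obj C \<Longrightarrow> Y \<in> Obj C \<Longrightarrow>
      comm_group \<lparr>carrier = Hom C X Y, monoid.mult = Add C, one = Zero C X Y\<rparr>"
    and Comp_Add_left: "f \<in> Hom C X Y \<Longrightarrow> g \<in> Hom C Y Z \<Longrightarrow> h \<in> Hom C Y Z \<Longrightarrow>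
      (g \<oplus> h) \<cdot> f = (g \<cdot> f) \<oplus> (h \<cdot> f)"
    and Comp_Add_right: "f \<in> Hom C X Y \<Longrightarrow> g \<in> Hom C X Y \<Longrightarrow> h \<in> Hom C Y Z \<Longrightarrow>
      h \<cdot> (f \<oplus> g) = (h \<cdot> f) \<oplus> (h \<cdot> g)"

definition is_zero_object :: "('o, 'm, 'z) cat_data_scheme \<Rightarrow> 'o \<Rightarrow> bool" where
  "is_zero_object C N \<longleftrightarrow> N \<in> Obj C \<and>
     (\<forall>X \<in> Obj C. (\<exists>!f. f \<in> Hom C N X) \<and> (\<exists>!f. f \<in> Hom C X N))"

definition is_biproduct ::
  "('o, 'm, 'z) preadd_data_scheme \<Rightarrow> 'o \<Rightarrow> 'o \<Rightarrow> 'o \<Rightarrow> 'm \<Rightarrow> 'm \<Rightarrow> 'm \<Rightarrow> 'm \<Rightarrow> bool" where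
  "is_biproduct C X Y P i j p q \<longleftrightarrow> P \<in> Obj C \<and>
     i \<in> Hom C X P \<and> j \<in> Hom C Y P \<and> p \<in> Hom C P X \<and> q \<in> Hom C P Y \<and>
     p \<cdot>\<^bsub>C\<^esub> i = Idt C X \<and> q \<cdot>\<^bsub>C\<^esub> j = Idt C Y \<and>
     p \<cdot>\<^bsub>C\<^esub> j = Zero C Y X \<and> q \<cdot>\<^bsub>C\<^esub> i = Zero C X Y \<and>
     (i \<cdot>\<^bsub>C\<^esub> p) \<oplus>\<^bsub>C\<^esub> (j \<cdot>\<^bsub>C\<^esub> q) = Idt C P"

locale additive_category = preadditive_category +
  assumes ex_zero_object: "\<exists>N. is_zero_object C N"
    and ex_biproduct: "X \<in> Obj C \<Longrightarrow> Y \<in> Obj C \<Longrightarrow>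
      \<exists>P i j p q. is_biproduct C X Y P i j p q"

definition is_kernel :: "('o, 'm, 'z) preadd_data_scheme \<Rightarrow> 'm \<Rightarrow> 'm \<Rightarrow> bool" where
  "is_kernel C f k \<longleftrightarrow> f \<in> Mor C \<and> k \<in> Mor C \<and> Cod C k = Dom C f \<and>
     f \<cdot>\<^bsub>C\<^esub> k = Zero C (Dom C k) (Cod C f) \<and>
     (\<forall>Z \<in> Obj C. \<forall>g \<in> Hom C Z (Dom C f). f \<cdot>\<^bsub>C\<^esub> g = Zero C Z (Cod C f) \<longrightarrow>
        (\<exists>!h. h \<in> Hom C Z (Dom C k) \<and> k \<cdot>\<^bsub>C\<^esub> h = g))"

definition is_cokernel :: "('o, 'm, 'z) preadd_data_scheme \<Rightarrow> 'm \<Rightarrow> 'm \<Rightarrow> bool" where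
  "is_cokernel C f q \<longleftrightarrow> f \<in> Mor C \<and> q \<in> Mor C \<and> Dom C q = Cod C f \<and>
     q \<cdot>\<^bsub>C\<^esub> f = Zero C (Dom C f) (Cod C q) \<and>
     (\<forall>Z \<in> Obj C. \<forall>g \<in> Hom C (Cod C f) Z. g \<cdot>\<^bsub>C\<^esub> f = Zero C (Dom C f) Z \<longrightarrow>
        (\<exists>!h. h \<in> Hom C (Cod C q) Z \<and> h \<cdot>\<^bsub>C\<^esub> q = g))"

locale abelian_category = additive_category +
  assumes ex_kernel: "f \<in> Mor C \<Longrightarrow> \<exists>k. is_kernel C f k"
    and ex_cokernel: "f \<in> Mor C \<Longrightarrow> \<exists>q. is_cokernel C f q"
    and mono_is_kernel: "is_mono C m \<Longrightarrow> \<exists>f. is_kernel C f m"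
    and epi_is_cokernel: "is_epi C e \<Longrightarrow> \<exists>f. is_cokernel C f e"

text \<open>The image of \<open>f\<close>, as a subobject of its codomain: the kernel of a cokernel of \<open>f\<close>.\<close>

definition is_image :: "('o, 'm, 'z) preadd_data_scheme \<Rightarrow> 'm \<Rightarrow> 'm \<Rightarrow> bool" where
  "is_image C f m \<longleftrightarrow> (\<exists>c. is_cokernel C f c \<and> is_kernel C c m)"


section \<open>Full subcategories, coreflections and traces\<close>

text \<open>A full subcategory is given by its set of objects \<open>S\<close>; identities, composition and
  addition are inherited.\<close>

definition full_sub ::
  "('o, 'm, 'z) cat_data_scheme \<Rightarrow> 'o set \<Rightarrow> ('o, 'm, 'z) cat_data_scheme" where
  "full_sub C S = C\<lparr>Obj := S, Mor := {f \<in> Mor C. Dom C f \<in> S \<and> Cod C f \<in> S}\<rparr>"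

definition replete :: "('o, 'm, 'z) cat_data_scheme \<Rightarrow> 'o set \<Rightarrow> bool" where
  "replete C S \<longleftrightarrow> S \<subseteq> Obj C \<and> (\<forall>X \<in> S. \<forall>Y \<in> Obj C. isomorphic C X Y \<longrightarrow> Y \<in> S)"

text \<open>The inclusion functor of \<open>full_sub C S\<close> is the identity on objects and on morphisms.\<close>

definition coreflective :: "('o, 'm, 'z) cat_data_scheme \<Rightarrow> 'o set \<Rightarrow> bool" where
  "coreflective C S \<longleftrightarrow>
     (\<exists>Ro Rm. is_right_adjoint (full_sub C S) C (\<lambda>X. X) (\<lambda>f. f) Ro Rm)"

definition is_coreflection :: "('o, 'm, 'z) cat_data_scheme \<Rightarrow> 'o set \<Rightarrow> 'm \<Rightarrow> bool" where
  "is_coreflection C S p \<longleftrightarrow> p \<in> Mor C \<and> Dom C p \<in> S \<and>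
     (\<forall>B \<in> S. bij_betw (\<lambda>h. p \<cdot>\<^bsub>C\<^esub> h) (Hom C B (Dom C p)) (Hom C B (Cod C p)))"

definition generated ::
  "'u itself \<Rightarrow> ('o, 'm, 'z) cat_data_scheme \<Rightarrow> 'o set \<Rightarrow> 'o \<Rightarrow> bool" where
  "generated (_ :: 'u itself) C S G \<longleftrightarrow>
     (\<exists>(I :: 'u set) X P \<iota> e. small I \<and> (\<forall>i \<in> I. X i \<in> S) \<and> is_coproduct C I X P \<iota> \<and>
        e \<in> Hom C P G \<and> is_epi C e)"

text \<open>The trace of \<open>S\<close> in \<open>A\<close>, represented by a monomorphism \<open>t\<close>: inclusion of subobjects
  of \<open>A\<close> is factorisation of the representing monomorphisms.\<close>

definition is_trace ::
  "'u itself \<Rightarrow> ('o, 'm, 'z) cat_data_scheme \<Rightarrow> 'o set \<Rightarrow> 'o \<Rightarrow> 'm \<Rightarrow> bool" where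
  "is_trace U C S A t \<longleftrightarrow>
     is_mono C t \<and> Cod C t = A \<and> generated U C S (Dom C t) \<and>
     (\<forall>s. is_mono C s \<and> Cod C s = A \<and> generated U C S (Dom C s) \<longrightarrow>
        (\<exists>h \<in> Hom C (Dom C s) (Dom C t). t \<cdot>\<^bsub>C\<^esub> h = s))"

text \<open>\<open>g\<close> is the morphism from \<open>Dom f / tr(Ker f)\<close> to \<open>Im f\<close> induced by \<open>f\<close>. Kernels, traces,
  quotients and images are determined only up to isomorphism, so \<open>g\<close> is described relative to
  any choice of them; for a given choice, \<open>m \<cdot> g \<cdot> q = f\<close> determines \<open>g\<close> since \<open>m\<close> is monic
  and \<open>q\<close> epic.\<close>

definition is_canonical_mor ::
  "'u itself \<Rightarrow> ('o, 'm, 'z) preadd_data_scheme \<Rightarrow> 'o set \<Rightarrow> 'm \<Rightarrow> 'm \<Rightarrow> bool" where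
  "is_canonical_mor U C S f g \<longleftrightarrow>
     (\<exists>k t q m. is_kernel C f k \<and> is_trace U C S (Dom C k) t \<and>
        is_cokernel C (k \<cdot>\<^bsub>C\<^esub> t) q \<and> is_image C f m \<and>
        g \<in> Hom C (Cod C q) (Dom C m) \<and> m \<cdot>\<^bsub>C\<^esub> g \<cdot>\<^bsub>C\<^esub> q = f)"

end

theory Submission imports Defs
begin

text \<open>A coreflective subcategory is closed under cokernels, and a kernel in it is the coreflection
  of the ambient kernel \<open>K\<close>. The trace of \<open>K\<close> is the image of its coreflection, so
  \<open>B / tr(Ker f)\<close> is the coimage of \<open>f\<close> formed in the subcategory, while the image of \<open>f\<close> formed
  there is the coreflection of \<open>Im f\<close>. Hence \<open>f\<close> has invertible coimage-image comparison in the
  subcategory iff the canonical morphism \<open>B / tr(Ker f) \<rightarrow> Im f\<close> is a coreflection.\<close>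

section \<open>Categories\<close>

text \<open>The obstacle is that a coreflection \<open>p\<close> of \<open>K\<close> need not be
  monic in the ambient category, so the kernel of \<open>f\<close> formed in the subcategory need
  not be a subobject of \<open>Ker f\<close> and cannot simply be identified with the trace. What
  survives is a vanishing test: a morphism out of \<open>K\<close> kills the trace iff it kills
  \<open>p\<close>. A cokernel sees nothing more, so the trace can be traded for
  \<open>k \<cdot> p\<close>. Abelian categories are defined here by normality of monos and epis,
  not by invertible comparison maps. The forward implication therefore extracts the comparison from
  normality, through lemmas proved for an arbitrary abelian category so that the subcategory can be
  substituted. The converse needs no general comparison: in
  \<open>f = m \<cdot> g \<cdot> q\<close>, a mono of the subcategory forces \<open>q\<close> to be
  invertible, an epi forces \<open>m\<close> to be, and the coreflection property of
  \<open>g\<close> supplies the rest.\<close>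

lemma HomD:
  assumes "f \<in> Hom C X Y"
  shows "f \<in> Mor C" "Dom C f = X" "Cod C f = Y"
  using assms by (auto simp: Hom_def)

lemma Mor_Hom: "f \<in> Mor C \<Longrightarrow> f \<in> Hom C (Dom C f) (Cod C f)"
  by (simp add: Hom_def)

lemma is_monoI:
  assumes f: "f \<in> Hom C X Y"
    and eq: "\<And>Z g h. Z \<in> Obj C \<Longrightarrow> g \<in> Hom C Z X \<Longrightarrow> h \<in> Hom C Z X \<Longrightarrow>
      f \<cdot>\<^bsub>C\<^esub> g = f \<cdot>\<^bsub>C\<^esub> h \<Longrightarrow> g = h"
  shows "is_mono C f"
  unfolding is_mono_def HomD(2)[OF f] using HomD(1)[OF f] eq by blast

lemma is_epiI:
  assumes f: "f \<in> Hom C X Y"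
    and eq: "\<And>Z g h. Z \<in> Obj C \<Longrightarrow> g \<in> Hom C Y Z \<Longrightarrow> h \<in> Hom C Y Z \<Longrightarrow>
      g \<cdot>\<^bsub>C\<^esub> f = h \<cdot>\<^bsub>C\<^esub> f \<Longrightarrow> g = h"
  shows "is_epi C f"
  unfolding is_epi_def HomD(3)[OF f] using HomD(1)[OF f] eq by blast

lemma is_monoD:
  assumes "is_mono C f" "f \<in> Hom C X Y" "Z \<in> Obj C" "g \<in> Hom C Z X" "h \<in> Hom C Z X"
    "f \<cdot>\<^bsub>C\<^esub> g = f \<cdot>\<^bsub>C\<^esub> h"
  shows "g = h"
  using assms unfolding is_mono_def Hom_def by auto

lemma is_epiD:
  assumes "is_epi C f" "f \<in> Hom C X Y" "Z \<in> Obj C" "g \<in> Hom C Y Z" "h \<in> Hom C Y Z"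
    "g \<cdot>\<^bsub>C\<^esub> f = h \<cdot>\<^bsub>C\<^esub> f"
  shows "g = h"
  using assms unfolding is_epi_def Hom_def by auto

context category
begin

lemma Hom_Obj:
  assumes "f \<in> Hom C X Y"
  shows "X \<in> Obj C" "Y \<in> Obj C"
  using assms Dom_in_Obj Cod_in_Obj by (auto simp: Hom_def)

lemma is_mono_comp:
  assumes f: "f \<in> Hom C X Y" "is_mono C f" and g: "g \<in> Hom C Y Z" "is_mono C g"
  shows "is_mono C (g \<cdot> f)"
proof (rule is_monoI[OF Comp_in_Hom[OF f(1) g(1)]])
  fix W u v
  assume W: "W \<in> Obj C" and u: "u \<in> Hom C W X" and v: "v \<in> Hom C W X"
    and "(g \<cdot> f) \<cdot> u = (g \<cdot> f) \<cdot> v"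
  then have "g \<cdot> (f \<cdot> u) = g \<cdot> (f \<cdot> v)" using Comp_assoc[OF u f(1) g(1)] Comp_assoc[OF v f(1) g(1)] by simp
  then have "f \<cdot> u = f \<cdot> v"
    using is_monoD[OF g(2,1) W Comp_in_Hom[OF u f(1)] Comp_in_Hom[OF v f(1)]] by simp
  then show "u = v" using is_monoD[OF f(2,1) W u v] by simp
qed

lemma is_epi_comp:
  assumes f: "f \<in> Hom C X Y" "is_epi C f" and g: "g \<in> Hom C Y Z" "is_epi C g"
  shows "is_epi C (g \<cdot> f)"
proof (rule is_epiI[OF Comp_in_Hom[OF f(1) g(1)]])
  fix W u v
  assume W: "W \<in> Obj C" and u: "u \<in> Hom C Z W" and v: "v \<in> Hom C Z W"
    and "u \<cdot> (g \<cdot> f) = v \<cdot> (g \<cdot> f)"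
  then have "(u \<cdot> g) \<cdot> f = (v \<cdot> g) \<cdot> f" using Comp_assoc[OF f(1) g(1) u] Comp_assoc[OF f(1) g(1) v] by simp
  then have "u \<cdot> g = v \<cdot> g"
    using is_epiD[OF f(2,1) W Comp_in_Hom[OF g(1) u] Comp_in_Hom[OF g(1) v]] by simp
  then show "u = v" using is_epiD[OF g(2,1) W u v] by simp
qed

lemma is_mono_cancel:
  assumes f: "f \<in> Hom C X Y" and g: "g \<in> Hom C Y Z" and gf: "is_mono C (g \<cdot> f)"
  shows "is_mono C f"
proof (rule is_monoI[OF f])
  fix W u v
  assume W: "W \<in> Obj C" and u: "u \<in> Hom C W X" and v: "v \<in> Hom C W X" and "f \<cdot> u = f \<cdot> v"
  then have "(g \<cdot> f) \<cdot> u = (g \<cdot> f) \<cdot> v" using Comp_assoc[OF u f g] Comp_assoc[OF v f g] by simp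
  then show "u = v" using is_monoD[OF gf Comp_in_Hom[OF f g] W u v] by simp
qed

lemma is_epi_cancel:
  assumes f: "f \<in> Hom C X Y" and g: "g \<in> Hom C Y Z" and gf: "is_epi C (g \<cdot> f)"
  shows "is_epi C g"
proof (rule is_epiI[OF g])
  fix W u v
  assume W: "W \<in> Obj C" and u: "u \<in> Hom C Z W" and v: "v \<in> Hom C Z W" and "u \<cdot> g = v \<cdot> g"
  then have "u \<cdot> (g \<cdot> f) = v \<cdot> (g \<cdot> f)" using Comp_assoc[OF f g u] Comp_assoc[OF f g v] by simp
  then show "u = v" using is_epiD[OF gf Comp_in_Hom[OF f g] W u v] by simp
qed

lemma mono_split_epi_inverse:
  assumes f: "f \<in> Hom C X Y" "is_mono C f" and v: "v \<in> Hom C Y X" "f \<cdot> v = Idt C Y"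
  shows "v \<cdot> f = Idt C X"
proof (rule is_monoD[OF f(2,1)])
  have "f \<cdot> (v \<cdot> f) = (f \<cdot> v) \<cdot> f" using Comp_assoc[OF f(1) v(1) f(1)] by simp
  then show "f \<cdot> (v \<cdot> f) = f \<cdot> Idt C X" using Idt_left Idt_right f v by simp
qed (use f v Hom_Obj Comp_in_Hom Idt_in_Hom in blast)+

end

section \<open>Kernels and cokernels in preadditive categories\<close>

lemma is_kernelD:
  assumes "is_kernel C f k" "f \<in> Hom C X Y"
  obtains K where "k \<in> Hom C K X" "f \<cdot>\<^bsub>C\<^esub> k = Zero C K Y"
  using assms unfolding is_kernel_def Hom_def by auto

lemma is_kernel_factor:
  assumes "is_kernel C f k" "f \<in> Hom C X Y" "k \<in> Hom C K X"
    "Z \<in> Obj C" "g \<in> Hom C Z X" "f \<cdot>\<^bsub>C\<^esub> g = Zero C Z Y"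
  obtains h where "h \<in> Hom C Z K" "k \<cdot>\<^bsub>C\<^esub> h = g"
proof -
  have "\<forall>Z \<in> Obj C. \<forall>g \<in> Hom C Z X. f \<cdot>\<^bsub>C\<^esub> g = Zero C Z Y \<longrightarrow> (\<exists>!h. h \<in> Hom C Z K \<and> k \<cdot>\<^bsub>C\<^esub> h = g)"
    using assms(1) unfolding is_kernel_def HomD[OF assms(2)] HomD[OF assms(3)] by blast
  with assms(4-6) that show thesis by blast
qed

lemma is_cokernelD:
  assumes "is_cokernel C f q" "f \<in> Hom C X Y"
  obtains Q where "q \<in> Hom C Y Q" "q \<cdot>\<^bsub>C\<^esub> f = Zero C X Q"
  using assms unfolding is_cokernel_def Hom_def by auto

lemma is_cokernel_factor:
  assumes "is_cokernel C f q" "f \<in> Hom C X Y" "q \<in> Hom C Y Q"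
    "Z \<in> Obj C" "g \<in> Hom C Y Z" "g \<cdot>\<^bsub>C\<^esub> f = Zero C X Z"
  obtains h where "h \<in> Hom C Q Z" "h \<cdot>\<^bsub>C\<^esub> q = g"
proof -
  have "\<forall>Z \<in> Obj C. \<forall>g \<in> Hom C Y Z. g \<cdot>\<^bsub>C\<^esub> f = Zero C X Z \<longrightarrow> (\<exists>!h. h \<in> Hom C Q Z \<and> h \<cdot>\<^bsub>C\<^esub> q = g)"
    using assms(1) unfolding is_cokernel_def HomD[OF assms(2)] HomD[OF assms(3)] by blast
  with assms(4-6) that show thesis by blast
qed

context preadditive_category
begin

lemma Zero_in_Hom: "X \<in> Obj C \<Longrightarrow> Y \<in> Obj C \<Longrightarrow> Zero C X Y \<in> Hom C X Y"
  using Hom_comm_group[of X Y] comm_group.axioms(2) group.is_monoid monoid.one_closed by fastforce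

text \<open>Composition with zero morphisms is not axiomatised. Bilinearity makes such a composite
  idempotent under \<open>Add\<close>, and idempotents of a group are neutral.\<close>

lemma Add_right_cancel_Zero:
  assumes "f \<in> Hom C X Y" "f \<oplus> f = f"
  shows "f = Zero C X Y"
proof -
  interpret G: comm_group "\<lparr>carrier = Hom C X Y, monoid.mult = Add C, one = Zero C X Y\<rparr>"
    using assms Hom_comm_group Hom_Obj by blast
  show ?thesis using G.l_cancel_one[of f f] assms by simp
qed

lemma Add_Zero_Zero: "X \<in> Obj C \<Longrightarrow> Y \<in> Obj C \<Longrightarrow> Zero C X Y \<oplus> Zero C X Y = Zero C X Y"
  using Hom_comm_group[of X Y] comm_group.axioms(2) group.is_monoid monoid.l_one Zero_in_Hom
  by fastforce

lemma Comp_Zero_right: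
  assumes f: "f \<in> Hom C Y Z" and X: "X \<in> Obj C"
  shows "f \<cdot> Zero C X Y = Zero C X Z"
  using Comp_Add_right[of "Zero C X Y" X Y "Zero C X Y" f Z] Add_Zero_Zero Zero_in_Hom Hom_Obj
    Comp_in_Hom Add_right_cancel_Zero f X by metis

lemma Comp_Zero_left:
  assumes f: "f \<in> Hom C X Y" and Z: "Z \<in> Obj C"
  shows "Zero C Y Z \<cdot> f = Zero C X Z"
  using Comp_Add_left[of f X Y "Zero C Y Z" Z "Zero C Y Z"] Add_Zero_Zero Zero_in_Hom Hom_Obj
    Comp_in_Hom Add_right_cancel_Zero f Z by metis

text \<open>The category data carry no subtraction; \<open>n\<close> is the negative of
  \<open>h\<close>. This packaging keeps the groups of morphisms out of the later proofs and allows
  cancellation to be tested against zero only.\<close>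

lemma ex_difference:
  assumes "g \<in> Hom C X Y" "h \<in> Hom C X Y"
  obtains n where "n \<in> Hom C X Y" "h \<oplus> n = Zero C X Y" "g \<oplus> n \<in> Hom C X Y"
    "g \<oplus> n = Zero C X Y \<Longrightarrow> g = h"
proof -
  let ?G = "\<lparr>carrier = Hom C X Y, monoid.mult = Add C, one = Zero C X Y\<rparr>"
  interpret G: comm_group ?G
    using assms Hom_comm_group Hom_Obj by blast
  show thesis
  proof (rule that[of "inv\<^bsub>?G\<^esub> h"])
    show "inv\<^bsub>?G\<^esub> h \<in> Hom C X Y" using G.inv_closed[of h] assms by simp
    show "h \<oplus> inv\<^bsub>?G\<^esub> h = Zero C X Y" using G.r_inv[of h] assms by simp
    show "g \<oplus> inv\<^bsub>?G\<^esub> h \<in> Hom C X Y"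
      using G.m_closed[of g "inv\<^bsub>?G\<^esub> h"] G.inv_closed[of h] assms by simp
    show "g = h" if "g \<oplus> inv\<^bsub>?G\<^esub> h = Zero C X Y"
      using G.inv_equality[of g "inv\<^bsub>?G\<^esub> h"] G.inv_closed[of h] G.inv_inv[of h] assms that by simp
  qed
qed

lemma is_mono_if_Zero:
  assumes f: "f \<in> Hom C X Y"
    and z: "\<And>Z g. Z \<in> Obj C \<Longrightarrow> g \<in> Hom C Z X \<Longrightarrow> f \<cdot> g = Zero C Z Y \<Longrightarrow> g = Zero C Z X"
  shows "is_mono C f"
proof (rule is_monoI[OF f])
  fix Z g h
  assume Z: "Z \<in> Obj C" and g: "g \<in> Hom C Z X" and h: "h \<in> Hom C Z X" and eq: "f \<cdot> g = f \<cdot> h"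
  obtain n where n: "n \<in> Hom C Z X" "h \<oplus> n = Zero C Z X" "g \<oplus> n \<in> Hom C Z X"
    "g \<oplus> n = Zero C Z X \<Longrightarrow> g = h" using ex_difference g h by blast
  have "f \<cdot> (g \<oplus> n) = f \<cdot> (h \<oplus> n)"
    using Comp_Add_right[OF g n(1) f] Comp_Add_right[OF h n(1) f] eq by simp
  then show "g = h" using n Comp_Zero_right f Z z by metis
qed

lemma is_epi_if_Zero:
  assumes f: "f \<in> Hom C X Y"
    and z: "\<And>Z g. Z \<in> Obj C \<Longrightarrow> g \<in> Hom C Y Z \<Longrightarrow> g \<cdot> f = Zero C X Z \<Longrightarrow> g = Zero C Y Z"
  shows "is_epi C f"
proof (rule is_epiI[OF f])
  fix Z g h
  assume Z: "Z \<in> Obj C" and g: "g \<in> Hom C Y Z" and h: "h \<in> Hom C Y Z" and eq: "g \<cdot> f = h \<cdot> f"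
  obtain n where n: "n \<in> Hom C Y Z" "h \<oplus> n = Zero C Y Z" "g \<oplus> n \<in> Hom C Y Z"
    "g \<oplus> n = Zero C Y Z \<Longrightarrow> g = h" using ex_difference g h by blast
  have "(g \<oplus> n) \<cdot> f = (h \<oplus> n) \<cdot> f"
    using Comp_Add_left[OF f g n(1)] Comp_Add_left[OF f h n(1)] eq by simp
  then show "g = h" using n Comp_Zero_left f Z z by metis
qed

lemma mono_ZeroD:
  assumes "is_mono C f" "f \<in> Hom C X Y" "g \<in> Hom C Z X" "f \<cdot> g = Zero C Z Y"
  shows "g = Zero C Z X"
  using assms is_monoD Comp_Zero_right Zero_in_Hom Hom_Obj by metis

lemma epi_ZeroD:
  assumes "is_epi C f" "f \<in> Hom C X Y" "g \<in> Hom C Y Z" "g \<cdot> f = Zero C X Z"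
  shows "g = Zero C Y Z"
  using assms is_epiD Comp_Zero_left Zero_in_Hom Hom_Obj by metis

lemma kernel_mono:
  assumes "is_kernel C f k"
  shows "is_mono C k"
proof -
  have f: "f \<in> Hom C (Dom C f) (Cod C f)" and k: "k \<in> Hom C (Dom C k) (Dom C f)"
    and fk: "f \<cdot> k = Zero C (Dom C k) (Cod C f)"
    using assms unfolding is_kernel_def Hom_def by auto
  show ?thesis
  proof (rule is_monoI[OF k])
    fix W u v
    assume W: "W \<in> Obj C" and u: "u \<in> Hom C W (Dom C k)" and v: "v \<in> Hom C W (Dom C k)"
      and eq: "k \<cdot> u = k \<cdot> v"
    have kv: "k \<cdot> v \<in> Hom C W (Dom C f)" using k v Comp_in_Hom by blast
    have "f \<cdot> (k \<cdot> v) = Zero C W (Cod C f)"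
      using Comp_assoc[OF v k f] fk Comp_Zero_left[OF v] Hom_Obj[OF f] by simp
    then have "\<exists>!h. h \<in> Hom C W (Dom C k) \<and> k \<cdot> h = k \<cdot> v"
      using assms W kv unfolding is_kernel_def by blast
    then show "u = v" using u v eq by blast
  qed
qed

lemma cokernel_epi:
  assumes "is_cokernel C f q"
  shows "is_epi C q"
proof -
  have f: "f \<in> Hom C (Dom C f) (Cod C f)" and q: "q \<in> Hom C (Cod C f) (Cod C q)"
    and qf: "q \<cdot> f = Zero C (Dom C f) (Cod C q)"
    using assms unfolding is_cokernel_def Hom_def by auto
  show ?thesis
  proof (rule is_epiI[OF q])
    fix W u v
    assume W: "W \<in> Obj C" and u: "u \<in> Hom C (Cod C q) W" and v: "v \<in> Hom C (Cod C q) W"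
      and eq: "u \<cdot> q = v \<cdot> q"
    have vq: "v \<cdot> q \<in> Hom C (Cod C f) W" using q v Comp_in_Hom by blast
    have "(v \<cdot> q) \<cdot> f = Zero C (Dom C f) W"
      using Comp_assoc[OF f q v] qf Comp_Zero_right[OF v] Hom_Obj[OF f] by simp
    then have "\<exists>!h. h \<in> Hom C (Cod C q) W \<and> h \<cdot> q = v \<cdot> q"
      using assms W vq unfolding is_cokernel_def by blast
    then show "u = v" using u v eq by blast
  qed
qed

text \<open>Uniqueness of the factorisation is exactly monicity of \<open>k\<close>, so only
  existence is left to supply.\<close>

lemma is_kernelI:
  assumes f: "f \<in> Hom C X Y" and k: "k \<in> Hom C K X" "is_mono C k" and fk: "f \<cdot> k = Zero C K Y"
    and fac: "\<And>Z g. Z \<in> Obj C \<Longrightarrow> g \<in> Hom C Z X \<Longrightarrow> f \<cdot> g = Zero C Z Y \<Longrightarrow>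
      \<exists>h \<in> Hom C Z K. k \<cdot> h = g"
  shows "is_kernel C f k"
proof -
  have "\<exists>!h. h \<in> Hom C Z K \<and> k \<cdot> h = g"
    if "Z \<in> Obj C" "g \<in> Hom C Z X" "f \<cdot> g = Zero C Z Y" for Z g
    using fac[OF that] is_monoD[OF k(2,1) that(1)] by metis
  then show ?thesis
    unfolding is_kernel_def HomD(2,3)[OF f] HomD(2,3)[OF k(1)] using HomD(1)[OF f] HomD(1)[OF k(1)] fk by blast
qed

lemma is_cokernelI:
  assumes f: "f \<in> Hom C X Y" and q: "q \<in> Hom C Y Q" "is_epi C q" and qf: "q \<cdot> f = Zero C X Q"
    and fac: "\<And>Z g. Z \<in> Obj C \<Longrightarrow> g \<in> Hom C Y Z \<Longrightarrow> g \<cdot> f = Zero C X Z \<Longrightarrow>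
      \<exists>h \<in> Hom C Q Z. h \<cdot> q = g"
  shows "is_cokernel C f q"
proof -
  have "\<exists>!h. h \<in> Hom C Q Z \<and> h \<cdot> q = g"
    if "Z \<in> Obj C" "g \<in> Hom C Y Z" "g \<cdot> f = Zero C X Z" for Z g
    using fac[OF that] is_epiD[OF q(2,1) that(1)] by metis
  then show ?thesis
    unfolding is_cokernel_def HomD(2,3)[OF f] HomD(2,3)[OF q(1)] using HomD(1)[OF f] HomD(1)[OF q(1)] qf by blast
qed

end

section \<open>Images and coimages in abelian categories\<close>

context abelian_category
begin

text \<open>The image is the smallest subobject through which \<open>f\<close> factors. If
  \<open>x\<close> kills \<open>e\<close>, then \<open>f\<close> already factors through the
  subobject \<open>Ker x\<close> of \<open>I\<close>, which must then be all of \<open>I\<close>, so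
  \<open>x\<close> is zero.\<close>

lemma image_epi:
  assumes f: "f \<in> Hom C X Y" and c: "is_cokernel C f c" and m: "is_kernel C c m" "m \<in> Hom C I Y"
    and e: "e \<in> Hom C X I" "m \<cdot> e = f"
  shows "is_epi C e"
proof (rule is_epi_if_Zero[OF e(1)])
  fix Z x assume Z: "Z \<in> Obj C" and x: "x \<in> Hom C I Z" and xe: "x \<cdot> e = Zero C X Z"
  obtain Q where cH: "c \<in> Hom C Y Q" using is_cokernelD[OF c f] .
  have cm: "c \<cdot> m = Zero C I Q" using is_kernelD[OF m(1) cH] m(2) by (metis HomD(2))
  obtain u where u: "is_kernel C x u" using ex_kernel HomD(1)[OF x] by blast
  obtain K where uH: "u \<in> Hom C K I" and xu: "x \<cdot> u = Zero C K Z" using is_kernelD[OF u x] .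
  obtain e' where e': "e' \<in> Hom C X K" "u \<cdot> e' = e"
    using is_kernel_factor[OF u x uH _ e(1) xe] Hom_Obj[OF f] by blast
  have mu: "m \<cdot> u \<in> Hom C K Y" using uH m Comp_in_Hom by blast
  \<comment> \<open>Normality of monos enters here: as the kernel of some \<open>w\<close>, the
    subobject \<open>m \<cdot> u\<close> is tested by \<open>w\<close>. Since \<open>w\<close> kills
    \<open>f\<close>, it factors through \<open>c\<close> and hence kills \<open>m\<close>, so
    \<open>m\<close> factors through \<open>m \<cdot> u\<close>.\<close>
  have "is_mono C (m \<cdot> u)" using is_mono_comp uH m kernel_mono u by blast
  then obtain w where w: "is_kernel C w (m \<cdot> u)" using mono_is_kernel by blast
  obtain W where wH: "w \<in> Hom C Y W" using w mu unfolding is_kernel_def Hom_def by auto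
  have wmu: "w \<cdot> (m \<cdot> u) = Zero C K W" using is_kernelD[OF w wH] mu by (metis HomD(2))
  have "w \<cdot> f = (w \<cdot> (m \<cdot> u)) \<cdot> e'"
    using Comp_assoc[OF e'(1) mu wH] Comp_assoc[OF e'(1) uH m(2)] e' e by simp
  then have "w \<cdot> f = Zero C X W" using wmu Comp_Zero_left e' wH Hom_Obj by metis
  then obtain w' where w': "w' \<in> Hom C Q W" "w' \<cdot> c = w"
    using is_cokernel_factor[OF c f cH _ wH] Hom_Obj[OF wH] by blast
  have "w \<cdot> m = Zero C I W"
    using Comp_assoc[OF m(2) cH w'(1)] w' cm Comp_Zero_right Hom_Obj[OF m(2)] by metis
  then obtain v where v: "v \<in> Hom C I K" "(m \<cdot> u) \<cdot> v = m"
    using is_kernel_factor[OF w wH mu _ m(2)] Hom_Obj[OF m(2)] by blast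
  have "m \<cdot> (u \<cdot> v) = m \<cdot> Idt C I" using Comp_assoc[OF v(1) uH m(2)] v Idt_right m by simp
  then have uv: "u \<cdot> v = Idt C I"
    using is_monoD[OF kernel_mono[OF m(1)] m(2)] Hom_Obj[OF x] Idt_in_Hom Comp_in_Hom v uH by blast
  have "x = (x \<cdot> u) \<cdot> v" using Comp_assoc[OF v(1) uH x] uv Idt_right[OF x] by simp
  then show "x = Zero C I Z" using xu Comp_Zero_left[OF v(1) Z] by simp
qed

text \<open>Dual to \<open>image_epi\<close>: the coimage is the smallest quotient through which
  \<open>f\<close> factors. If \<open>n\<close> kills \<open>x\<close>, then \<open>f\<close>
  factors through the further quotient \<open>u \<cdot> q\<close>, and normality of that epi makes
  \<open>u\<close> a split mono.\<close>

lemma coimage_mono: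
  assumes f: "f \<in> Hom C X Y" and k: "is_kernel C f k" and q: "is_cokernel C k q" "q \<in> Hom C X Q"
    and n: "n \<in> Hom C Q Y" "n \<cdot> q = f"
  shows "is_mono C n"
proof (rule is_mono_if_Zero[OF n(1)])
  fix Z x assume Z: "Z \<in> Obj C" and x: "x \<in> Hom C Z Q" and nx: "n \<cdot> x = Zero C Z Y"
  obtain K where kH: "k \<in> Hom C K X" using is_kernelD[OF k f] .
  have qk: "q \<cdot> k = Zero C K Q" using is_cokernelD[OF q(1) kH] q(2) by (metis HomD(3))
  obtain u where u: "is_cokernel C x u" using ex_cokernel HomD(1)[OF x] by blast
  obtain U where uH: "u \<in> Hom C Q U" and ux: "u \<cdot> x = Zero C Z U" using is_cokernelD[OF u x] .
  obtain n' where n': "n' \<in> Hom C U Y" "n' \<cdot> u = n"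
    using is_cokernel_factor[OF u x uH _ n(1) nx] Hom_Obj[OF f] by blast
  have uq: "u \<cdot> q \<in> Hom C X U" using uH q Comp_in_Hom by blast
  have "is_epi C (u \<cdot> q)" using is_epi_comp uH q cokernel_epi u by blast
  then obtain w where w: "is_cokernel C w (u \<cdot> q)" using epi_is_cokernel by blast
  obtain W where wH: "w \<in> Hom C W X" using w uq unfolding is_cokernel_def Hom_def by auto
  have wuq: "(u \<cdot> q) \<cdot> w = Zero C W U" using is_cokernelD[OF w wH] uq by (metis HomD(3))
  have "f \<cdot> w = n' \<cdot> ((u \<cdot> q) \<cdot> w)"
    using Comp_assoc[OF wH uq n'(1)] Comp_assoc[OF q(2) uH n'(1)] n' n by simp
  then have "f \<cdot> w = Zero C W Y" using wuq Comp_Zero_right n' wH Hom_Obj by metis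
  then obtain w' where w': "w' \<in> Hom C W K" "k \<cdot> w' = w"
    using is_kernel_factor[OF k f kH _ wH] Hom_Obj[OF wH] by blast
  have "q \<cdot> w = Zero C W Q"
    using Comp_assoc[OF w'(1) kH q(2)] w' qk Comp_Zero_left Hom_Obj[OF q(2)] by metis
  then obtain v where v: "v \<in> Hom C U Q" "v \<cdot> (u \<cdot> q) = q"
    using is_cokernel_factor[OF w wH uq _ q(2)] Hom_Obj[OF q(2)] by blast
  have "(v \<cdot> u) \<cdot> q = Idt C Q \<cdot> q" using Comp_assoc[OF q(2) uH v(1)] v Idt_left q by simp
  then have vu: "v \<cdot> u = Idt C Q"
    using is_epiD[OF cokernel_epi[OF q(1)] q(2)] Hom_Obj[OF x] Idt_in_Hom Comp_in_Hom v uH by blast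
  have "x = v \<cdot> (u \<cdot> x)" using Comp_assoc[OF x uH v(1)] vu Idt_left[OF x] by simp
  then show "x = Zero C Z Q" using ux Comp_Zero_right[OF v(1) Z] by simp
qed

text \<open>A mono is the kernel of some \<open>w\<close>; being epic as well, it forces
  \<open>w\<close> to be zero, so the identity of \<open>Y\<close> factors through
  \<open>f\<close>.\<close>

lemma mono_epi_iso:
  assumes f: "f \<in> Hom C X Y" and m: "is_mono C f" and e: "is_epi C f"
  obtains v where "v \<in> Hom C Y X" "v \<cdot> f = Idt C X" "f \<cdot> v = Idt C Y"
proof -
  obtain w where w: "is_kernel C w f" using mono_is_kernel m by blast
  obtain W where wH: "w \<in> Hom C Y W" using w f unfolding is_kernel_def Hom_def by auto
  have "w \<cdot> f = Zero C X W" using is_kernelD[OF w wH] f by (metis HomD(2))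
  then have "w = Zero C Y W" using epi_ZeroD e f wH by blast
  then have "w \<cdot> Idt C Y = Zero C Y W" using Idt_right wH by simp
  then obtain v where v: "v \<in> Hom C Y X" "f \<cdot> v = Idt C Y"
    using is_kernel_factor[OF w wH f] Idt_in_Hom Hom_Obj[OF f] by metis
  with mono_split_epi_inverse[OF f m] that show thesis by blast
qed

end

section \<open>Full coreflective subcategories\<close>

lemma full_sub_simps [simp]:
  "Obj (full_sub C S) = S"
  "Dom (full_sub C S) = Dom C"
  "Cod (full_sub C S) = Cod C"
  "Idt (full_sub C S) = Idt C"
  "Comp (full_sub C S) = Comp C"
  "Mor (full_sub C S) = {f \<in> Mor C. Dom C f \<in> S \<and> Cod C f \<in> S}"
  by (simp_all add: full_sub_def)

lemma full_sub_preadd_simps [simp]: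
  "Add (full_sub C S) = Add C"
  "Zero (full_sub C S) = Zero C"
  by (simp_all add: full_sub_def)

lemma Hom_full_sub: "Hom (full_sub C S) X Y = (if X \<in> S \<and> Y \<in> S then Hom C X Y else {})"
  by (auto simp: Hom_def)

text \<open>The coreflection is the counit of the adjunction, and the adjunction bijection
  \<open>\<phi>\<close> is the inverse of composition with it.\<close>

lemma coreflective_ex_coreflection:
  assumes C: "category C" and S: "S \<subseteq> Obj C" and co: "coreflective C S" and X: "X \<in> Obj C"
  obtains p R where "p \<in> Hom C R X" "is_coreflection C S p"
proof -
  interpret category C by fact
  obtain Ro Rm \<phi> where fu: "is_functor C (full_sub C S) Ro Rm"
    and bij: "\<And>Z Y. Z \<in> S \<Longrightarrow> Y \<in> Obj C \<Longrightarrow> bij_betw (\<phi> Z Y) (Hom C Z Y) (Hom (full_sub C S) Z (Ro Y))"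
    and nat: "\<And>Z' Z Y Y' u h v. Z' \<in> S \<Longrightarrow> Z \<in> S \<Longrightarrow> Y \<in> Obj C \<Longrightarrow> Y' \<in> Obj C \<Longrightarrow>
      u \<in> Hom (full_sub C S) Z' Z \<Longrightarrow> h \<in> Hom C Z Y \<Longrightarrow> v \<in> Hom C Y Y' \<Longrightarrow>
      \<phi> Z' Y' (v \<cdot>\<^bsub>C\<^esub> h \<cdot>\<^bsub>C\<^esub> u) = Rm v \<cdot>\<^bsub>C\<^esub> \<phi> Z Y h \<cdot>\<^bsub>C\<^esub> u"
    using co unfolding coreflective_def is_right_adjoint_def full_sub_simps by (elim exE conjE) blast
  define R where "R = Ro X"
  have R: "R \<in> S" and Rm: "Rm (Idt C X) = Idt C R"
    using fu X unfolding is_functor_def R_def by auto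
  have idR: "Idt C R \<in> Hom C R R" using R S Idt_in_Hom by blast
  have bij': "bij_betw (\<phi> Z X) (Hom C Z X) (Hom C Z R)" if "Z \<in> S" for Z
    using bij[OF that X] that R unfolding R_def[symmetric] by (simp add: Hom_full_sub)
  \<comment> \<open>The counit corresponds to the identity of \<open>R\<close> under the
    adjunction.\<close>
  obtain p where p: "p \<in> Hom C R X" "\<phi> R X p = Idt C R"
    using bij'[OF R] idR by (metis bij_betw_imp_surj_on imageE)
  \<comment> \<open>Naturality along \<open>u\<close> and the identity of \<open>X\<close>, applied
    to \<open>p\<close>, shows that \<open>\<phi>\<close> undoes composition with \<open>p\<close>.
    The other composite then follows from injectivity of \<open>\<phi>\<close>.\<close>
  have \<phi>p: "\<phi> Z X (p \<cdot>\<^bsub>C\<^esub> u) = u" if "Z \<in> S" "u \<in> Hom C Z R" for Z u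
    using nat[OF that(1) R X X _ p(1) Idt_in_Hom[OF X], of u] that R Rm p Idt_left idR
    by (simp add: Hom_full_sub)
  have "bij_betw (\<lambda>h. p \<cdot>\<^bsub>C\<^esub> h) (Hom C Z R) (Hom C Z X)" if Z: "Z \<in> S" for Z
  proof (rule bij_betw_byWitness[where f' = "\<phi> Z X"])
    show "\<forall>a\<in>Hom C Z R. \<phi> Z X (p \<cdot>\<^bsub>C\<^esub> a) = a" using \<phi>p Z by blast
    have 1: "\<phi> Z X h \<in> Hom C Z R" if "h \<in> Hom C Z X" for h
      using bij'[OF Z] that bij_betwE by blast
    then show "\<phi> Z X ` Hom C Z X \<subseteq> Hom C Z R" by blast
    show im: "(\<lambda>h. p \<cdot>\<^bsub>C\<^esub> h) ` Hom C Z R \<subseteq> Hom C Z X" using Comp_in_Hom p by blast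
    show "\<forall>a'\<in>Hom C Z X. p \<cdot>\<^bsub>C\<^esub> \<phi> Z X a' = a'"
    proof
      fix h assume h: "h \<in> Hom C Z X"
      have "\<phi> Z X (p \<cdot>\<^bsub>C\<^esub> \<phi> Z X h) = \<phi> Z X h" using \<phi>p Z 1 h by blast
      moreover have "p \<cdot>\<^bsub>C\<^esub> \<phi> Z X h \<in> Hom C Z X" using im 1 h by blast
      ultimately show "p \<cdot>\<^bsub>C\<^esub> \<phi> Z X h = h" using bij'[OF Z] h by (metis bij_betw_imp_inj_on inj_onD)
    qed
  qed
  then have "is_coreflection C S p" using p R unfolding is_coreflection_def by (simp add: HomD)
  with p that show thesis by blast
qed

lemma coreflection_factor:
  assumes "is_coreflection C S p" "p \<in> Hom C R X" "Z \<in> S" "h \<in> Hom C Z X"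
  obtains u where "u \<in> Hom C Z R" "p \<cdot>\<^bsub>C\<^esub> u = h"
proof -
  have "bij_betw (\<lambda>h. p \<cdot>\<^bsub>C\<^esub> h) (Hom C Z R) (Hom C Z X)"
    using assms(1,3) unfolding is_coreflection_def HomD[OF assms(2)] by blast
  then have "h \<in> (\<lambda>h. p \<cdot>\<^bsub>C\<^esub> h) ` Hom C Z R" using assms(4) bij_betw_imp_surj_on by blast
  with that show thesis by blast
qed

lemma coreflection_inj:
  assumes "is_coreflection C S p" "p \<in> Hom C R X" "Z \<in> S" "u \<in> Hom C Z R" "v \<in> Hom C Z R"
    "p \<cdot>\<^bsub>C\<^esub> u = p \<cdot>\<^bsub>C\<^esub> v"
  shows "u = v"
proof -
  have "bij_betw (\<lambda>h. p \<cdot>\<^bsub>C\<^esub> h) (Hom C Z R) (Hom C Z X)"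
    using assms(1,3) unfolding is_coreflection_def HomD[OF assms(2)] by blast
  then show ?thesis using assms(4-6) by (auto dest: bij_betw_imp_inj_on inj_onD)
qed

lemma coreflection_Dom: "is_coreflection C S p \<Longrightarrow> p \<in> Hom C R X \<Longrightarrow> R \<in> S"
  unfolding is_coreflection_def by (simp add: HomD)

locale coreflective_subcategory = abelian_category C
  for C :: "('o, 'm, 'z) preadd_data_scheme" (structure) +
  fixes S :: "'o set"
  assumes replete: "replete C S"
    and additive_sub: "additive_category (full_sub C S)"
    and coreflective: "coreflective C S"
begin

sublocale sub: additive_category "full_sub C S"
  by (rule additive_sub)

lemma sub_Obj: "X \<in> S \<Longrightarrow> X \<in> Obj C"
  using replete unfolding replete_def by blast

lemma ex_coreflection:
  assumes "X \<in> Obj C"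
  obtains p R where "p \<in> Hom C R X" "is_coreflection C S p" "R \<in> S"
proof -
  have "S \<subseteq> Obj C" using sub_Obj by blast
  then obtain p R where p: "p \<in> Hom C R X" "is_coreflection C S p"
    using coreflective_ex_coreflection[OF category_axioms _ coreflective assms] by blast
  with that coreflection_Dom[OF p(2,1)] show thesis by blast
qed

text \<open>The coreflection \<open>p\<close> of the ambient cokernel is invertible. Its inverse
  \<open>s\<close> comes from lifting \<open>c\<close> through \<open>p\<close> and observing that
  the lift still kills \<open>f\<close>; repleteness then puts \<open>Q\<close> into
  \<open>S\<close>.\<close>

lemma cokernel_in_sub:
  assumes f: "f \<in> Hom C X Y" "X \<in> S" "Y \<in> S" and c: "is_cokernel C f c" "c \<in> Hom C Y Q"
  shows "Q \<in> S"
proof -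
  have Q: "Q \<in> Obj C" using Hom_Obj c by blast
  obtain p R where p: "p \<in> Hom C R Q" "is_coreflection C S p" "R \<in> S" using ex_coreflection[OF Q] .
  obtain d where d: "d \<in> Hom C Y R" "p \<cdot> d = c" using coreflection_factor[OF p(2,1) f(3) c(2)] .
  have cf: "c \<cdot> f = Zero C X Q" using is_cokernelD[OF c(1) f(1)] c(2) by (metis HomD(3))
  \<comment> \<open>Only morphisms out of objects of \<open>S\<close> can be cancelled against
    \<open>p\<close>; the source \<open>X\<close> is one.\<close>
  have "d \<cdot> f = Zero C X R"
  proof (rule coreflection_inj[OF p(2,1) f(2)])
    show "p \<cdot> (d \<cdot> f) = p \<cdot> Zero C X R"
      using Comp_assoc[OF f(1) d(1) p(1)] d cf Comp_Zero_right[OF p(1)] sub_Obj f by simp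
  qed (use f d Comp_in_Hom Zero_in_Hom Hom_Obj in blast)+
  then obtain s where s: "s \<in> Hom C Q R" "s \<cdot> c = d"
    using is_cokernel_factor[OF c(1) f(1) c(2) _ d(1)] sub_Obj p by blast
  have "(p \<cdot> s) \<cdot> c = Idt C Q \<cdot> c" using Comp_assoc[OF c(2) s(1) p(1)] s d Idt_left c by simp
  then have ps: "p \<cdot> s = Idt C Q"
    using is_epiD[OF cokernel_epi[OF c(1)] c(2) Q] Comp_in_Hom s p Idt_in_Hom Q by blast
  have "s \<cdot> p = Idt C R"
  proof (rule coreflection_inj[OF p(2,1) p(3)])
    show "p \<cdot> (s \<cdot> p) = p \<cdot> Idt C R"
      using Comp_assoc[OF p(1) s(1) p(1)] ps Idt_left Idt_right p by simp
  qed (use p s Comp_in_Hom Idt_in_Hom sub_Obj in blast)+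
  with ps p s have "isomorphic C R Q" unfolding isomorphic_def by blast
  then show ?thesis using replete p Q unfolding replete_def by blast
qed

text \<open>Once the target lies in \<open>S\<close>, fullness lets the universal property
  restrict.\<close>

lemma cokernel_sub:
  assumes f: "f \<in> Hom C X Y" "X \<in> S" "Y \<in> S" and c: "is_cokernel C f c"
  shows "is_cokernel (full_sub C S) f c"
proof -
  obtain Q where cH: "c \<in> Hom C Y Q" using is_cokernelD[OF c f(1)] .
  have "Q \<in> S" using cokernel_in_sub f c cH by blast
  then show ?thesis using c f cH sub_Obj
    unfolding is_cokernel_def by (auto simp: HomD Hom_full_sub)
qed

text \<open>For \<open>Z\<close> in \<open>S\<close>, morphisms from \<open>Z\<close> to
  \<open>R\<close> correspond to those from \<open>Z\<close> to \<open>K\<close>, hence to those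
  from \<open>Z\<close> to \<open>X\<close> killed by \<open>f\<close>. Monicity of
  \<open>k \<cdot> p\<close> is claimed in the subcategory only.\<close>

lemma kernel_sub:
  assumes f: "f \<in> Hom C X Y" "X \<in> S" "Y \<in> S" and k: "is_kernel C f k" "k \<in> Hom C K X"
    and p: "is_coreflection C S p" "p \<in> Hom C R K"
  shows "is_kernel (full_sub C S) f (k \<cdot> p)"
proof (rule sub.is_kernelI)
  have R: "R \<in> S" using coreflection_Dom[OF p] .
  have kp: "k \<cdot> p \<in> Hom C R X" using k p Comp_in_Hom by blast
  show "f \<in> Hom (full_sub C S) X Y" "k \<cdot> p \<in> Hom (full_sub C S) R X"
    using f kp R by (auto simp: Hom_full_sub)
  have fk: "f \<cdot> k = Zero C K Y" using is_kernelD[OF k(1) f(1)] k(2) by (metis HomD(2))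
  show "f \<cdot>\<^bsub>full_sub C S\<^esub> (k \<cdot> p) = Zero (full_sub C S) R Y"
    using Comp_assoc[OF p(2) k(2) f(1)] fk Comp_Zero_left[OF p(2)] sub_Obj f by simp
  show "is_mono (full_sub C S) (k \<cdot> p)"
  proof (rule is_monoI)
    show "k \<cdot> p \<in> Hom (full_sub C S) R X" using f kp R by (auto simp: Hom_full_sub)
    fix Z u v
    assume "Z \<in> Obj (full_sub C S)" "u \<in> Hom (full_sub C S) Z R" "v \<in> Hom (full_sub C S) Z R"
      "(k \<cdot> p) \<cdot>\<^bsub>full_sub C S\<^esub> u = (k \<cdot> p) \<cdot>\<^bsub>full_sub C S\<^esub> v"
    then have Z: "Z \<in> S" and u: "u \<in> Hom C Z R" and v: "v \<in> Hom C Z R"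
      and "(k \<cdot> p) \<cdot> u = (k \<cdot> p) \<cdot> v" using R by (auto simp: Hom_full_sub)
    then have "k \<cdot> (p \<cdot> u) = k \<cdot> (p \<cdot> v)"
      using Comp_assoc[OF u p(2) k(2)] Comp_assoc[OF v p(2) k(2)] by simp
    then have "p \<cdot> u = p \<cdot> v"
      using is_monoD[OF kernel_mono[OF k(1)] k(2) sub_Obj[OF Z] Comp_in_Hom[OF u p(2)] Comp_in_Hom[OF v p(2)]]
      by simp
    then show "u = v" using coreflection_inj[OF p Z u v] by simp
  qed
  show "\<exists>h\<in>Hom (full_sub C S) Z R. (k \<cdot> p) \<cdot>\<^bsub>full_sub C S\<^esub> h = g"
    if "Z \<in> Obj (full_sub C S)" "g \<in> Hom (full_sub C S) Z X"
      "f \<cdot>\<^bsub>full_sub C S\<^esub> g = Zero (full_sub C S) Z Y" for Z g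
  proof -
    have Z: "Z \<in> S" and g: "g \<in> Hom C Z X" "f \<cdot> g = Zero C Z Y"
      using that f by (auto simp: Hom_full_sub)
    obtain h where h: "h \<in> Hom C Z K" "k \<cdot> h = g"
      using is_kernel_factor[OF k(1) f(1) k(2) sub_Obj[OF Z] g] .
    obtain u where "u \<in> Hom C Z R" "p \<cdot> u = h" using coreflection_factor[OF p Z h(1)] .
    then show ?thesis using h Comp_assoc[OF _ p(2) k(2)] Z R by (auto simp: Hom_full_sub)
  qed
qed

section \<open>Traces\<close>

text \<open>On each summand \<open>s \<cdot> e\<close> lifts through \<open>p\<close>, and the lifts
  assemble over the coproduct. The morphism \<open>s\<close> itself need not lift; passing to an
  epic cover \<open>e\<close> of its source is harmless wherever vanishing is tested.\<close>

lemma generated_factors_coreflection: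
  assumes p: "is_coreflection C S p" "p \<in> Hom C R K"
    and s: "s \<in> Hom C G K" "generated TYPE('u) C S G"
  obtains P e h where "e \<in> Hom C P G" "is_epi C e" "h \<in> Hom C P R" "p \<cdot> h = s \<cdot> e"
proof -
  obtain I :: "'u set" and X P \<iota> e where X: "\<And>i. i \<in> I \<Longrightarrow> X i \<in> S" and co: "is_coproduct C I X P \<iota>"
    and e: "e \<in> Hom C P G" "is_epi C e" using s unfolding generated_def by blast
  have se: "s \<cdot> e \<in> Hom C P K" using s e Comp_in_Hom by blast
  have i: "\<iota> i \<in> Hom C (X i) P" if "i \<in> I" for i using co that unfolding is_coproduct_def by blast
  have "\<exists>u. u \<in> Hom C (X i) R \<and> p \<cdot> u = (s \<cdot> e) \<cdot> \<iota> i" if "i \<in> I" for i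
    using coreflection_factor[OF p X[OF that]] Comp_in_Hom[OF i[OF that] se] by metis
  then obtain u where u: "\<And>i. i \<in> I \<Longrightarrow> u i \<in> Hom C (X i) R \<and> p \<cdot> u i = (s \<cdot> e) \<cdot> \<iota> i" by metis
  have R: "R \<in> Obj C" "K \<in> Obj C" using p Hom_Obj by blast+
  obtain h where h: "h \<in> Hom C P R" "\<forall>i\<in>I. h \<cdot> \<iota> i = u i"
    using co R u unfolding is_coproduct_def by metis
  have "\<forall>i\<in>I. (s \<cdot> e) \<cdot> \<iota> i \<in> Hom C (X i) K" using i se Comp_in_Hom by blast
  then have uniq: "\<exists>!h. h \<in> Hom C P K \<and> (\<forall>i \<in> I. h \<cdot> \<iota> i = (s \<cdot> e) \<cdot> \<iota> i)"
    using co R unfolding is_coproduct_def by simp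
  have "p \<cdot> h \<in> Hom C P K" using p h Comp_in_Hom by blast
  moreover have "\<forall>i\<in>I. (p \<cdot> h) \<cdot> \<iota> i = (s \<cdot> e) \<cdot> \<iota> i" using h u Comp_assoc[OF i h(1) p(2)] by simp
  ultimately have "p \<cdot> h = s \<cdot> e" using uniq se by blast
  with e h that show thesis by blast
qed

text \<open>\<open>R\<close> is its own coproduct over a one-element index set, which is small
  because the universe is infinite.\<close>

lemma generated_quotient:
  assumes u: "infinite (UNIV :: 'u set)" and e: "e \<in> Hom C R G" "is_epi C e" and R: "R \<in> S"
  shows "generated TYPE('u) C S G"
proof -
  fix a :: 'u
  have "small {a}" unfolding small_def by (rule finite_lesspoll_infinite) (use u in auto)
  moreover have "is_coproduct C {a} (\<lambda>_. R) R (\<lambda>_. Idt C R)"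
    unfolding is_coproduct_def using Idt_in_Hom Idt_right sub_Obj[OF R] by auto
  ultimately show ?thesis using e R unfolding generated_def
    by (intro exI[of _ "{a}"] exI[of _ "\<lambda>_. R"] exI[of _ R] exI[of _ "\<lambda>_. Idt C R"] exI[of _ e]) simp
qed

text \<open>The epic part of the factorisation of \<open>p\<close> exhibits its image as a quotient
  of \<open>R\<close>, an object of \<open>S\<close>.\<close>

lemma coreflection_image:
  assumes u: "infinite (UNIV :: 'u set)" and p: "is_coreflection C S p" "p \<in> Hom C R K"
  obtains J j e where "j \<in> Hom C J K" "is_mono C j" "e \<in> Hom C R J" "j \<cdot> e = p"
    "generated TYPE('u) C S J"
proof -
  obtain c where c: "is_cokernel C p c" using ex_cokernel[OF HomD(1)[OF p(2)]] by blast
  obtain Q where cH: "c \<in> Hom C K Q" "c \<cdot> p = Zero C R Q" using is_cokernelD[OF c p(2)] .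
  obtain j where j: "is_kernel C c j" using ex_kernel[OF HomD(1)[OF cH(1)]] by blast
  obtain J where jH: "j \<in> Hom C J K" using is_kernelD[OF j cH(1)] .
  obtain e where e: "e \<in> Hom C R J" "j \<cdot> e = p"
    using is_kernel_factor[OF j cH(1) jH _ p(2) cH(2)] Hom_Obj p by blast
  have "is_epi C e" using image_epi[OF p(2) c j jH e] .
  then show thesis using that jH kernel_mono j e generated_quotient[OF u] coreflection_Dom[OF p] by blast
qed

lemma ex_trace:
  assumes u: "infinite (UNIV :: 'u set)" and K: "K \<in> Obj C"
  shows "\<exists>t. is_trace TYPE('u) C S K t"
proof -
  obtain p R where p: "p \<in> Hom C R K" "is_coreflection C S p" using ex_coreflection[OF K] .
  obtain J j e where j: "j \<in> Hom C J K" "is_mono C j" and e: "e \<in> Hom C R J" "j \<cdot> e = p"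
    and g: "generated TYPE('u) C S J" using coreflection_image[OF u p(2,1)] .
  have "\<exists>h\<in>Hom C (Dom C s) J. j \<cdot> h = s"
    if s: "is_mono C s" "Cod C s = K" "generated TYPE('u) C S (Dom C s)" for s
  proof -
    have sH: "s \<in> Hom C (Dom C s) K" using s unfolding is_mono_def Hom_def by blast
    obtain P d h where d: "d \<in> Hom C P (Dom C s)" "is_epi C d" and h: "h \<in> Hom C P R" "p \<cdot> h = s \<cdot> d"
      using generated_factors_coreflection[OF p(2,1) sH s(3)] .
    \<comment> \<open>Factoring \<open>s\<close> through \<open>j\<close> becomes the equation
      \<open>w \<cdot> s = 0\<close>. It may be checked after the epi \<open>d\<close>, where
      \<open>s \<cdot> d = p \<cdot> h\<close> passes through \<open>j\<close>.\<close>
    obtain w where w: "is_kernel C w j" using mono_is_kernel j by blast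
    obtain W where wH: "w \<in> Hom C K W" using w j unfolding is_kernel_def Hom_def by auto
    have wj: "w \<cdot> j = Zero C J W" using is_kernelD[OF w wH] j by (metis HomD(2))
    have eh: "e \<cdot> h \<in> Hom C P J" using e h Comp_in_Hom by blast
    have "(w \<cdot> s) \<cdot> d = (w \<cdot> j) \<cdot> (e \<cdot> h)"
      using Comp_assoc[OF d(1) sH wH] Comp_assoc[OF eh j(1) wH] Comp_assoc[OF h(1) e(1) j(1)] h e by simp
    also have "\<dots> = Zero C P W" using wj Comp_Zero_left[OF eh] Hom_Obj[OF wH] by simp
    finally have "w \<cdot> s = Zero C (Dom C s) W" using epi_ZeroD[OF d(2,1)] Comp_in_Hom sH wH by blast
    then show ?thesis using is_kernel_factor[OF w wH j(1) _ sH] Hom_Obj[OF sH] by blast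
  qed
  then show ?thesis using j g unfolding is_trace_def by (auto simp: HomD)
qed

text \<open>One direction holds because \<open>p\<close> factors through \<open>t\<close>, by
  maximality of the trace. For the other, \<open>t\<close> composed with an epic cover of
  \<open>T\<close> factors through \<open>p\<close>.\<close>

lemma trace_Zero_iff:
  assumes u: "infinite (UNIV :: 'u set)" and p: "is_coreflection C S p" "p \<in> Hom C R K"
    and t: "is_trace TYPE('u) C S K t" "t \<in> Hom C T K" and x: "x \<in> Hom C K Z"
  shows "x \<cdot> t = Zero C T Z \<longleftrightarrow> x \<cdot> p = Zero C R Z"
proof
  obtain J j e where j: "j \<in> Hom C J K" "is_mono C j" and e: "e \<in> Hom C R J" "j \<cdot> e = p"
    and g: "generated TYPE('u) C S J" using coreflection_image[OF u p] .
  obtain h where h: "h \<in> Hom C J T" "t \<cdot> h = j"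
    using t j g unfolding is_trace_def by (metis HomD(2,3))
  have he: "h \<cdot> e \<in> Hom C R T" using h e Comp_in_Hom by blast
  have p_eq: "p = t \<cdot> (h \<cdot> e)" using Comp_assoc[OF e(1) h(1) t(2)] h e by simp
  assume "x \<cdot> t = Zero C T Z"
  then show "x \<cdot> p = Zero C R Z"
    using p_eq Comp_assoc[OF he t(2) x] Comp_Zero_left[OF he] Hom_Obj x by simp
next
  have "generated TYPE('u) C S T" using t unfolding is_trace_def by (simp add: HomD)
  then obtain P d h where d: "d \<in> Hom C P T" "is_epi C d" and h: "h \<in> Hom C P R" "p \<cdot> h = t \<cdot> d"
    using generated_factors_coreflection[OF p t(2)] by blast
  assume 0: "x \<cdot> p = Zero C R Z"
  have "(x \<cdot> t) \<cdot> d = (x \<cdot> p) \<cdot> h" using Comp_assoc[OF d(1) t(2) x] Comp_assoc[OF h(1) p(2) x] h by simp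
  also have "\<dots> = Zero C P Z" using 0 Comp_Zero_left[OF h(1)] Hom_Obj x by simp
  finally show "x \<cdot> t = Zero C T Z" using epi_ZeroD[OF d(2,1)] Comp_in_Hom t x by blast
qed

text \<open>The same morphisms kill \<open>k \<cdot> t\<close> and \<open>k \<cdot> p\<close>, and a
  cokernel depends only on which morphisms vanish. Since \<open>k \<cdot> p\<close> is the kernel in
  the subcategory, \<open>q\<close> becomes the coimage there.\<close>

lemma trace_cokernel:
  assumes u: "infinite (UNIV :: 'u set)" and k: "k \<in> Hom C K X"
    and p: "is_coreflection C S p" "p \<in> Hom C R K"
    and t: "is_trace TYPE('u) C S K t" and q: "is_cokernel C (k \<cdot> t) q"
  shows "is_cokernel C (k \<cdot> p) q"
proof -
  obtain T where tH: "t \<in> Hom C T K" using t unfolding is_trace_def is_mono_def Hom_def by auto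
  have kt: "k \<cdot> t \<in> Hom C T X" and kp: "k \<cdot> p \<in> Hom C R X" using k p tH Comp_in_Hom by blast+
  obtain Q where qH: "q \<in> Hom C X Q" "q \<cdot> (k \<cdot> t) = Zero C T Q" using is_cokernelD[OF q kt] .
  have iff: "x \<cdot> (k \<cdot> t) = Zero C T Z \<longleftrightarrow> x \<cdot> (k \<cdot> p) = Zero C R Z" if x: "x \<in> Hom C X Z" for x Z
    using trace_Zero_iff[OF u p t tH Comp_in_Hom[OF k x]] Comp_assoc[OF tH k x] Comp_assoc[OF p(2) k x]
    by simp
  show ?thesis
  proof (rule is_cokernelI[OF kp qH(1) cokernel_epi[OF q]])
    show "q \<cdot> (k \<cdot> p) = Zero C R Q" using iff qH by blast
    show "\<exists>h\<in>Hom C Q Z. h \<cdot> q = g" if "Z \<in> Obj C" "g \<in> Hom C X Z" "g \<cdot> (k \<cdot> p) = Zero C R Z" for Z g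
      using is_cokernel_factor[OF q kt qH(1) that(1,2)] iff[OF that(2)] that(3) by metis
  qed
qed

section \<open>From an abelian subcategory to canonical morphisms that are coreflections\<close>

lemma canonical_mor_is_coreflection:
  assumes u: "infinite (UNIV :: 'u set)" and ab: "abelian_category (full_sub C S)"
    and f: "f \<in> Hom C X Y" "X \<in> S" "Y \<in> S" and g: "is_canonical_mor TYPE('u) C S f g"
  shows "is_coreflection C S g"
proof -
  interpret ab: abelian_category "full_sub C S" by fact
  obtain k t q m c where k: "is_kernel C f k" and t: "is_trace TYPE('u) C S (Dom C k) t"
    and q: "is_cokernel C (k \<cdot> t) q" and c: "is_cokernel C f c" and m: "is_kernel C c m"
    and g: "g \<in> Hom C (Cod C q) (Dom C m)" and f_eq: "m \<cdot> g \<cdot> q = f"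
    using g unfolding is_canonical_mor_def is_image_def by blast
  obtain K where kH: "k \<in> Hom C K X" using is_kernelD[OF k f(1)] .
  obtain p R where p: "p \<in> Hom C R K" "is_coreflection C S p" "R \<in> S" using ex_coreflection[OF Hom_Obj(1)[OF kH]] by blast
  have t: "is_trace TYPE('u) C S K t" using t kH by (simp add: HomD)
  have kp: "k \<cdot> p \<in> Hom C R X" using kH p Comp_in_Hom by blast
  have ker: "is_kernel (full_sub C S) f (k \<cdot> p)" using kernel_sub[OF f k kH p(2,1)] .
  have q': "is_cokernel C (k \<cdot> p) q" using trace_cokernel[OF u kH p(2,1) t q] .
  obtain Q where qH: "q \<in> Hom C X Q" using is_cokernelD[OF q' kp] .
  have Q: "Q \<in> S" using cokernel_in_sub[OF kp p(3) f(2) q' qH] .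
  have coim: "is_cokernel (full_sub C S) (k \<cdot> p) q" using cokernel_sub[OF kp p(3) f(2) q'] .
  obtain D where cH: "c \<in> Hom C Y D" using is_cokernelD[OF c f(1)] .
  have D: "D \<in> S" using cokernel_in_sub[OF f c cH] .
  have coker: "is_cokernel (full_sub C S) f c" using cokernel_sub[OF f c] .
  obtain I where mH: "m \<in> Hom C I Y" using is_kernelD[OF m cH] .
  obtain r V where r: "r \<in> Hom C V I" "is_coreflection C S r" "V \<in> S" using ex_coreflection[OF Hom_Obj(1)[OF mH]] by blast
  have im: "is_kernel (full_sub C S) c (m \<cdot> r)" using kernel_sub[OF cH f(3) D m mH r(2,1)] .
  have mr: "m \<cdot> r \<in> Hom C V Y" using mH r Comp_in_Hom by blast
  have gH: "g \<in> Hom C Q I" using g qH mH by (simp add: HomD)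
  \<comment> \<open>This lift is the coimage-image comparison of \<open>f\<close> in the
    subcategory. It suffices to invert it, since \<open>g = r \<cdot> a\<close> with
    \<open>r\<close> a coreflection.\<close>
  obtain a where a: "a \<in> Hom C Q V" "r \<cdot> a = g" using coreflection_factor[OF r(2,1) Q gH] .
  have aq: "a \<cdot> q \<in> Hom C X V" and mra: "(m \<cdot> r) \<cdot> a \<in> Hom C Q Y" using a qH mr Comp_in_Hom by blast+
  have mra_q: "(m \<cdot> r) \<cdot> a \<cdot> q = f" using Comp_assoc[OF a(1) r(1) mH] a f_eq by simp
  then have mr_aq: "(m \<cdot> r) \<cdot> (a \<cdot> q) = f" using Comp_assoc[OF qH a(1) mr] by simp
  \<comment> \<open>\<open>f\<close> factors through its coimage \<open>q\<close> by this morphism,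
    which is therefore monic in the subcategory; so is its first factor \<open>a\<close>.\<close>
  have "is_mono (full_sub C S) ((m \<cdot> r) \<cdot> a)"
    using ab.coimage_mono[OF _ ker coim, of X Y Q "(m \<cdot> r) \<cdot> a"] f Q qH mra mra_q
    by (simp add: Hom_full_sub)
  then have mono: "is_mono (full_sub C S) a"
    using sub.is_mono_cancel[of a Q V "m \<cdot> r" Y] a mr r(3) Q f by (simp add: Hom_full_sub)
  \<comment> \<open>Likewise \<open>f\<close> factors through its image \<open>m \<cdot> r\<close>
    by \<open>a \<cdot> q\<close>, which makes \<open>a\<close> epic.\<close>
  have "is_epi (full_sub C S) (a \<cdot> q)"
    using ab.image_epi[OF _ coker im, of X Y V "a \<cdot> q"] f r(3) mr aq mr_aq by (simp add: Hom_full_sub)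
  then have epi: "is_epi (full_sub C S) a"
    using sub.is_epi_cancel[of q X Q a V] a qH r(3) Q f by (simp add: Hom_full_sub)
  obtain b where b: "b \<in> Hom C V Q" "b \<cdot> a = Idt C Q" "a \<cdot> b = Idt C V"
    using ab.mono_epi_iso[OF _ mono epi, of Q V] a Q r(3) by (auto simp: Hom_full_sub)
  \<comment> \<open>Composition with \<open>g\<close> is composition with \<open>a\<close>, inverted
    by \<open>b\<close>, followed by composition with \<open>r\<close>, bijective on objects of
    \<open>S\<close>.\<close>
  have "bij_betw (\<lambda>h. g \<cdot> h) (Hom C Z Q) (Hom C Z I)" if Z: "Z \<in> S" for Z
  proof (rule bij_betw_imageI)
    have assoc: "g \<cdot> h = r \<cdot> (a \<cdot> h)" if "h \<in> Hom C Z Q" for h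
      using Comp_assoc[OF that a(1) r(1)] a by simp
    show "inj_on (\<lambda>h. g \<cdot> h) (Hom C Z Q)"
    proof (rule inj_onI)
      fix h h' assume h: "h \<in> Hom C Z Q" "h' \<in> Hom C Z Q" "g \<cdot> h = g \<cdot> h'"
      have "a \<cdot> h = a \<cdot> h'"
        using coreflection_inj[OF r(2,1) Z Comp_in_Hom[OF h(1) a(1)] Comp_in_Hom[OF h(2) a(1)]] assoc h
        by simp
      then have "(b \<cdot> a) \<cdot> h = (b \<cdot> a) \<cdot> h'"
        using Comp_assoc[OF h(1) a(1) b(1)] Comp_assoc[OF h(2) a(1) b(1)] by simp
      then show "h = h'" using b Idt_left h by simp
    qed
    show "(\<lambda>h. g \<cdot> h) ` Hom C Z Q = Hom C Z I"
    proof
      show "(\<lambda>h. g \<cdot> h) ` Hom C Z Q \<subseteq> Hom C Z I" using gH Comp_in_Hom by blast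
      show "Hom C Z I \<subseteq> (\<lambda>h. g \<cdot> h) ` Hom C Z Q"
      proof
        fix h assume "h \<in> Hom C Z I"
        then obtain w where w: "w \<in> Hom C Z V" "r \<cdot> w = h" using coreflection_factor[OF r(2,1) Z] by blast
        have bw: "b \<cdot> w \<in> Hom C Z Q" using b w Comp_in_Hom by blast
        have "g \<cdot> (b \<cdot> w) = h" using assoc[OF bw] Comp_assoc[OF w(1) b(1) a(1)] b w Idt_left by simp
        with bw show "h \<in> (\<lambda>h. g \<cdot> h) ` Hom C Z Q" by blast
      qed
    qed
  qed
  then show ?thesis using gH Q unfolding is_coreflection_def by (simp add: HomD)
qed

text \<open>Assertion (2) quantifies over all canonical morphisms, so using it requires one to
  exist. As \<open>f\<close> kills \<open>k \<cdot> t\<close>, it descends along \<open>q\<close>;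
  the descended morphism is still killed by \<open>c\<close> because \<open>q\<close> is epic, so it
  lifts through \<open>m\<close>.\<close>

lemma ex_canonical_mor:
  assumes u: "infinite (UNIV :: 'u set)" and f: "f \<in> Hom C X Y"
    and k: "is_kernel C f k" "k \<in> Hom C K X" and c: "is_cokernel C f c" and m: "is_kernel C c m" "m \<in> Hom C I Y"
  obtains t q Q g where "is_trace TYPE('u) C S K t" "is_cokernel C (k \<cdot> t) q"
    "q \<in> Hom C X Q" "g \<in> Hom C Q I" "m \<cdot> g \<cdot> q = f" "is_canonical_mor TYPE('u) C S f g"
proof -
  obtain D where cH: "c \<in> Hom C Y D" "c \<cdot> f = Zero C X D" using is_cokernelD[OF c f] .
  have fk: "f \<cdot> k = Zero C K Y" using is_kernelD[OF k(1) f(1)] k(2) by (metis HomD(2))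
  obtain t where t: "is_trace TYPE('u) C S K t" using ex_trace[OF u] Hom_Obj k by blast
  obtain T where tH: "t \<in> Hom C T K" using t unfolding is_trace_def is_mono_def Hom_def by auto
  have kt: "k \<cdot> t \<in> Hom C T X" using k tH Comp_in_Hom by blast
  obtain q where q: "is_cokernel C (k \<cdot> t) q" using ex_cokernel[OF HomD(1)[OF kt]] by blast
  obtain Q where qH: "q \<in> Hom C X Q" using is_cokernelD[OF q kt] .
  have "f \<cdot> (k \<cdot> t) = Zero C T Y"
    using Comp_assoc[OF tH k(2) f] fk Comp_Zero_left[OF tH] Hom_Obj f by simp
  then obtain f' where f': "f' \<in> Hom C Q Y" "f' \<cdot> q = f"
    using is_cokernel_factor[OF q kt qH _ f] Hom_Obj f by blast
  have "(c \<cdot> f') \<cdot> q = Zero C X D" using Comp_assoc[OF qH f'(1) cH(1)] f' cH by simp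
  then have "c \<cdot> f' = Zero C Q D"
    using epi_ZeroD[OF cokernel_epi[OF q] qH] Comp_in_Hom f' cH by blast
  then obtain g where g: "g \<in> Hom C Q I" "m \<cdot> g = f'"
    using is_kernel_factor[OF m(1) cH(1) m(2) _ f'(1)] Hom_Obj f' by blast
  have "is_canonical_mor TYPE('u) C S f g"
    unfolding is_canonical_mor_def is_image_def using k t q c m g f' qH by (metis HomD(2,3))
  with that t q qH g f' show thesis by blast
qed

section \<open>Normality of the monos and epis of the subcategory, from canonical
  coreflections\<close>

lemma sub_mono_is_kernel:
  assumes u: "infinite (UNIV :: 'u set)" and f: "f \<in> Hom C X Y" "X \<in> S" "Y \<in> S"
    and canon: "\<And>g. is_canonical_mor TYPE('u) C S f g \<Longrightarrow> is_coreflection C S g"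
    and mono: "is_mono (full_sub C S) f"
  shows "\<exists>c. is_kernel (full_sub C S) c f"
proof -
  obtain k where k: "is_kernel C f k" using ex_kernel[OF HomD(1)[OF f(1)]] by blast
  obtain K where kH: "k \<in> Hom C K X" using is_kernelD[OF k f(1)] .
  obtain c where c: "is_cokernel C f c" using ex_cokernel[OF HomD(1)[OF f(1)]] by blast
  obtain D where cH: "c \<in> Hom C Y D" "c \<cdot> f = Zero C X D" using is_cokernelD[OF c f(1)] .
  have D: "D \<in> S" using cokernel_in_sub[OF f c cH(1)] .
  obtain m where m: "is_kernel C c m" using ex_kernel[OF HomD(1)[OF cH(1)]] by blast
  obtain I where mH: "m \<in> Hom C I Y" using is_kernelD[OF m cH(1)] .
  obtain t q Q g where t: "is_trace TYPE('u) C S K t" and q: "is_cokernel C (k \<cdot> t) q"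
    and qH: "q \<in> Hom C X Q" and g: "g \<in> Hom C Q I" "m \<cdot> g \<cdot> q = f" and "is_canonical_mor TYPE('u) C S f g"
    using ex_canonical_mor[OF u f(1) k kH c m mH] .
  then have gco: "is_coreflection C S g" using canon by blast
  obtain p R where p: "p \<in> Hom C R K" "is_coreflection C S p" "R \<in> S" using ex_coreflection[OF Hom_Obj(1)[OF kH]] by blast
  have kp: "k \<cdot> p \<in> Hom C R X" using kH p Comp_in_Hom by blast
  have "is_kernel (full_sub C S) f (k \<cdot> p)" using kernel_sub[OF f k kH p(2,1)] .
  then have "f \<cdot> (k \<cdot> p) = Zero C R Y"
    using kp f p unfolding is_kernel_def by (simp add: HomD)
  then have kp0: "k \<cdot> p = Zero C R X"
    using sub.mono_ZeroD[OF mono, of X Y "k \<cdot> p" R] kp f p by (simp add: Hom_full_sub)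
  have q': "is_cokernel C (k \<cdot> p) q" using trace_cokernel[OF u kH p(2,1) t q] .
  \<comment> \<open>Now \<open>q\<close> is a cokernel of a zero morphism, so the identity factors
    through it and \<open>s\<close> is a two-sided inverse.\<close>
  have "Idt C X \<cdot> (k \<cdot> p) = Zero C R X" using Idt_left kp kp0 by simp
  then obtain s where s: "s \<in> Hom C Q X" "s \<cdot> q = Idt C X"
    using is_cokernel_factor[OF q' kp qH] Idt_in_Hom sub_Obj f by metis
  have "(q \<cdot> s) \<cdot> q = Idt C Q \<cdot> q" using Comp_assoc[OF qH s(1) qH] s Idt_left Idt_right qH by simp
  then have qs: "q \<cdot> s = Idt C Q"
    using is_epiD[OF cokernel_epi[OF q'] qH] Hom_Obj qH s Comp_in_Hom Idt_in_Hom by meson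
  have mg: "m \<cdot> g \<in> Hom C Q Y" using mH g Comp_in_Hom by blast
  \<comment> \<open>Since \<open>g\<close> is a coreflection of the image,
    \<open>m \<cdot> g\<close> has the universal property of the kernel of \<open>c\<close> in the
    subcategory; \<open>f\<close> differs from it by the invertible \<open>q\<close>.\<close>
  have "is_kernel (full_sub C S) c f"
  proof (rule sub.is_kernelI)
    show "c \<in> Hom (full_sub C S) Y D" "f \<in> Hom (full_sub C S) X Y"
      using cH f D by (auto simp: Hom_full_sub)
    show "is_mono (full_sub C S) f" by fact
    show "c \<cdot>\<^bsub>full_sub C S\<^esub> f = Zero (full_sub C S) X D" using cH by simp
    show "\<exists>h\<in>Hom (full_sub C S) Z X. f \<cdot>\<^bsub>full_sub C S\<^esub> h = x"
      if "Z \<in> Obj (full_sub C S)" "x \<in> Hom (full_sub C S) Z Y"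
        "c \<cdot>\<^bsub>full_sub C S\<^esub> x = Zero (full_sub C S) Z D" for Z x
    proof -
      have Z: "Z \<in> S" and x: "x \<in> Hom C Z Y" "c \<cdot> x = Zero C Z D"
        using that f by (auto simp: Hom_full_sub)
      obtain y where y: "y \<in> Hom C Z I" "m \<cdot> y = x"
        using is_kernel_factor[OF m cH(1) mH sub_Obj[OF Z] x] .
      obtain z where z: "z \<in> Hom C Z Q" "g \<cdot> z = y" using coreflection_factor[OF gco g(1) Z y(1)] .
      have sz: "s \<cdot> z \<in> Hom C Z X" using s z Comp_in_Hom by blast
      have "f \<cdot> (s \<cdot> z) = (m \<cdot> g) \<cdot> (q \<cdot> (s \<cdot> z))" using Comp_assoc[OF sz qH mg] g by simp
      also have "q \<cdot> (s \<cdot> z) = z" using Comp_assoc[OF z(1) s(1) qH] qs Idt_left z by simp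
      also have "(m \<cdot> g) \<cdot> z = x" using Comp_assoc[OF z(1) g(1) mH] z y by simp
      finally show ?thesis using sz Z f by (auto simp: Hom_full_sub)
    qed
  qed
  then show ?thesis by blast
qed

lemma sub_epi_is_cokernel:
  assumes u: "infinite (UNIV :: 'u set)" and f: "f \<in> Hom C X Y" "X \<in> S" "Y \<in> S"
    and canon: "\<And>g. is_canonical_mor TYPE('u) C S f g \<Longrightarrow> is_coreflection C S g"
    and epi: "is_epi (full_sub C S) f"
  shows "\<exists>h. is_cokernel (full_sub C S) h f"
proof -
  obtain k where k: "is_kernel C f k" using ex_kernel[OF HomD(1)[OF f(1)]] by blast
  obtain K where kH: "k \<in> Hom C K X" using is_kernelD[OF k f(1)] .
  obtain c where c: "is_cokernel C f c" using ex_cokernel[OF HomD(1)[OF f(1)]] by blast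
  obtain D where cH: "c \<in> Hom C Y D" "c \<cdot> f = Zero C X D" using is_cokernelD[OF c f(1)] .
  have D: "D \<in> S" using cokernel_in_sub[OF f c cH(1)] .
  obtain m where m: "is_kernel C c m" using ex_kernel[OF HomD(1)[OF cH(1)]] by blast
  obtain I where mH: "m \<in> Hom C I Y" using is_kernelD[OF m cH(1)] .
  obtain t q Q g where t: "is_trace TYPE('u) C S K t" and q: "is_cokernel C (k \<cdot> t) q"
    and qH: "q \<in> Hom C X Q" and g: "g \<in> Hom C Q I" "m \<cdot> g \<cdot> q = f" and "is_canonical_mor TYPE('u) C S f g"
    using ex_canonical_mor[OF u f(1) k kH c m mH] .
  then have gco: "is_coreflection C S g" using canon by blast
  obtain p R where p: "p \<in> Hom C R K" "is_coreflection C S p" "R \<in> S" using ex_coreflection[OF Hom_Obj(1)[OF kH]] by blast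
  have kp: "k \<cdot> p \<in> Hom C R X" using kH p Comp_in_Hom by blast
  have ker: "is_kernel (full_sub C S) f (k \<cdot> p)" using kernel_sub[OF f k kH p(2,1)] .
  have q': "is_cokernel C (k \<cdot> p) q" using trace_cokernel[OF u kH p(2,1) t q] .
  \<comment> \<open>The cokernel \<open>c\<close> lies in the subcategory, so epicness there applies
    to it. A kernel \<open>m\<close> of a zero morphism is invertible, with inverse
    \<open>v\<close>.\<close>
  have "c = Zero C Y D"
    using sub.epi_ZeroD[OF epi, of X Y c D] cH f D by (simp add: Hom_full_sub)
  then have "c \<cdot> Idt C Y = Zero C Y D" using Idt_right cH by simp
  then obtain v where v: "v \<in> Hom C Y I" "m \<cdot> v = Idt C Y"
    using is_kernel_factor[OF m cH(1) mH] Idt_in_Hom sub_Obj f by metis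
  have vm: "v \<cdot> m = Idt C I" using mono_split_epi_inverse[OF mH kernel_mono[OF m] v] .
  obtain w where w: "w \<in> Hom C Y Q" "g \<cdot> w = v" using coreflection_factor[OF gco g(1) f(3) v(1)] .
  have mg: "m \<cdot> g \<in> Hom C Q Y" using mH g Comp_in_Hom by blast
  have Q: "Q \<in> S" using coreflection_Dom[OF gco g(1)] .
  \<comment> \<open>Lifting \<open>v\<close> through the coreflection \<open>g\<close> yields an
    inverse of \<open>m \<cdot> g\<close>. Cancelling \<open>g\<close> on the left is legitimate
    because \<open>Q\<close> lies in \<open>S\<close>, not because \<open>g\<close> is
    monic.\<close>
  have "w \<cdot> (m \<cdot> g) = Idt C Q"
  proof (rule coreflection_inj[OF gco g(1) Q])
    have "g \<cdot> (w \<cdot> (m \<cdot> g)) = v \<cdot> (m \<cdot> g)" using Comp_assoc[OF mg w(1) g(1)] w by simp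
    also have "\<dots> = g \<cdot> Idt C Q" using Comp_assoc[OF g(1) mH v(1)] vm Idt_left Idt_right g by simp
    finally show "g \<cdot> (w \<cdot> (m \<cdot> g)) = g \<cdot> Idt C Q" .
  qed (use w mg Comp_in_Hom Idt_in_Hom sub_Obj Q in blast)+
  \<comment> \<open>So \<open>f\<close> agrees with \<open>q\<close> up to the isomorphism
    \<open>w\<close> and inherits being a cokernel of \<open>k \<cdot> p\<close>.\<close>
  then have q_eq: "w \<cdot> f = q" using Comp_assoc[OF qH mg w(1)] g Idt_left qH by simp
  have "is_cokernel (full_sub C S) (k \<cdot> p) f"
  proof (rule sub.is_cokernelI)
    show "k \<cdot> p \<in> Hom (full_sub C S) R X" "f \<in> Hom (full_sub C S) X Y"
      using kp f p by (auto simp: Hom_full_sub)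
    show "is_epi (full_sub C S) f" by fact
    show "f \<cdot>\<^bsub>full_sub C S\<^esub> (k \<cdot> p) = Zero (full_sub C S) R Y"
      using ker kp f p unfolding is_kernel_def by (simp add: HomD)
    show "\<exists>h\<in>Hom (full_sub C S) Y Z. h \<cdot>\<^bsub>full_sub C S\<^esub> f = x"
      if "Z \<in> Obj (full_sub C S)" "x \<in> Hom (full_sub C S) X Z"
        "x \<cdot>\<^bsub>full_sub C S\<^esub> (k \<cdot> p) = Zero (full_sub C S) R Z" for Z x
    proof -
      have Z: "Z \<in> S" and x: "x \<in> Hom C X Z" "x \<cdot> (k \<cdot> p) = Zero C R Z"
        using that f by (auto simp: Hom_full_sub)
      obtain y where y: "y \<in> Hom C Q Z" "y \<cdot> q = x"
        using is_cokernel_factor[OF q' kp qH sub_Obj[OF Z] x] .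
      have "(y \<cdot> w) \<cdot> f = x" using Comp_assoc[OF f(1) w(1) y(1)] q_eq y by simp
      moreover have "y \<cdot> w \<in> Hom C Y Z" using y w Comp_in_Hom by blast
      ultimately show ?thesis using Z f by (auto simp: Hom_full_sub)
    qed
  qed
  then show ?thesis by blast
qed

lemma sub_abelian:
  assumes u: "infinite (UNIV :: 'u set)"
    and canon: "\<And>f g. f \<in> Mor (full_sub C S) \<Longrightarrow> is_canonical_mor TYPE('u) C S f g \<Longrightarrow> is_coreflection C S g"
  shows "abelian_category (full_sub C S)"
proof
  fix f assume "f \<in> Mor (full_sub C S)"
  then have f: "f \<in> Hom C (Dom C f) (Cod C f)" "Dom C f \<in> S" "Cod C f \<in> S" by (auto simp: Hom_def)
  obtain k where k: "is_kernel C f k" using ex_kernel[OF HomD(1)[OF f(1)]] by blast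
  obtain K where kH: "k \<in> Hom C K (Dom C f)" using is_kernelD[OF k f(1)] .
  obtain p R where "p \<in> Hom C R K" "is_coreflection C S p" using ex_coreflection[OF Hom_Obj(1)[OF kH]] by blast
  then show "\<exists>k. is_kernel (full_sub C S) f k" using kernel_sub[OF f k kH] by blast
  obtain c where "is_cokernel C f c" using ex_cokernel[OF HomD(1)[OF f(1)]] by blast
  then show "\<exists>q. is_cokernel (full_sub C S) f q" using cokernel_sub[OF f] by blast
next
  fix f assume f: "is_mono (full_sub C S) f"
  then have fM: "f \<in> Mor (full_sub C S)" unfolding is_mono_def by blast
  then have "f \<in> Hom C (Dom C f) (Cod C f)" "Dom C f \<in> S" "Cod C f \<in> S" by (auto simp: Hom_def)
  from sub_mono_is_kernel[OF u this canon[OF fM] f]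
  show "\<exists>c. is_kernel (full_sub C S) c f" by blast
next
  fix f assume f: "is_epi (full_sub C S) f"
  then have fM: "f \<in> Mor (full_sub C S)" unfolding is_epi_def by blast
  then have "f \<in> Hom C (Dom C f) (Cod C f)" "Dom C f \<in> S" "Cod C f \<in> S" by (auto simp: Hom_def)
  from sub_epi_is_cokernel[OF u this canon[OF fM] f]
  show "\<exists>h. is_cokernel (full_sub C S) h f" by blast
qed

end

theorem theorem7p6:
  fixes A :: "('o, 'm) preadd_data" and B :: "'o set"
  assumes "infinite (UNIV :: 'u set)"
    and "abelian_category A"
    and "cocomplete TYPE('u) A"
    and "replete A B"
    and "additive_category (full_sub A B)"
    and "coreflective A B"
  shows "abelian_category (full_sub A B) \<longleftrightarrow>
    (\<forall>f \<in> Mor (full_sub A B). \<forall>g.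
       is_canonical_mor TYPE('u) A B f g \<longrightarrow> is_coreflection A B g)"
proof -
  interpret coreflective_subcategory A B
    using assms by (simp add: coreflective_subcategory_def coreflective_subcategory_axioms_def)
  show ?thesis
  proof (intro iffI ballI allI impI)
    fix f g assume ab: "abelian_category (full_sub A B)" and f: "f \<in> Mor (full_sub A B)"
      and g: "is_canonical_mor TYPE('u) A B f g"
    then show "is_coreflection A B g"
      using canonical_mor_is_coreflection[OF assms(1) ab Mor_Hom _ _ g] by simp
  next
    assume "\<forall>f \<in> Mor (full_sub A B). \<forall>g.
      is_canonical_mor TYPE('u) A B f g \<longrightarrow> is_coreflection A B g"
    then show "abelian_category (full_sub A B)" using sub_abelian[OF assms(1)] by blast
  qed
qed

end
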